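(* Let $F_X$ be a $d$-dimensional generalized inner product distribution with signature $(p,q)$, let $X_1,X_2,\dots$ be i.i.d. with distribution $F_X$, let $X\sim F_X$, and suppose $\mathbf{\Delta}:=\mathbb{E}[XX^{\top}]$ is such that $\mathbf{\Delta}\mathbf{I}_{p,q}$ is full-rank (its eigenvalues may be repeated). For each $n$ let $\mathbf{Q_X}$ be the $d\times d$ matrix with $\mathbf{U_P}|\mathbf{\Lambda_P}|^{1/2}\mathbf{Q_X}=\mathbf{X}$. Then there exist a sequence of (random) matrices $\mathbf{W}_n\in O(d)\cap O(p,q)$ and a deterministic matrix $\tilde{\mathbf{Q}}$ such that $$\|\mathbf{W}_n\mathbf{Q_X}-\tilde{\mathbf{Q}}\|\to 0\quad\text{almost surely as } n\to\infty.$$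
   Context: Let $d=p+q$ and $\mathbf{I}_{p,q}:=\mathrm{diag}(\mathbf{I}_p,-\mathbf{I}_q)$, where $\mathbf{I}_r$ is the $r\times r$ identity. A distribution $F_X$ on $\mathbb{R}^d$ is a $d$-dimensional generalized inner product distribution with signature $(p,q)$ if it takes values in a set $\Omega\subset\mathbb{R}^d$ with $x^{\top}\mathbf{I}_{p,q}y\in[0,1]$ for all $x,y\in\Omega$. $O(d)$ is the orthogonal group and $O(p,q)=\{\mathbf{Q}\in\mathbb{R}^{d\times d}:\mathbf{Q}\mathbf{I}_{p,q}\mathbf{Q}^{\top}=\mathbf{I}_{p,q}\}$. $\|\cdot\|$ is the spectral norm. For each $n$, $\mathbf{X}$ is the $n\times d$ matrix whose $i$-th row is $X_i^{\top}$, and $\mathbf{P}:=\mathbf{X}\mathbf{I}_{p,q}\mathbf{X}^{\top}$. When $\mathbf{X}$ has rank $d$ (which holds almost surely for all large $n$ if $\mathbf{\Delta}$ is invertible), write the eigendecomposition restricted to the $d$ nonzero eigenvalues as $\mathbf{P}=\mathbf{U_P}\mathbf{\Lambda_P}\mathbf{U_P}^{\top}$, where $\mathbf{\Lambda_P}$ is the $d\times d$ diagonal matrix of nonzero eigenvalues of $\mathbf{P}$ ordered from largest to smallest (so the $p$ positive ones come first) and $\mathbf{U_P}$ is $n\times d$ with orthonormal columns (any choice of orthonormal eigenvectors). $|\mathbf{\Lambda_P}|$ denotes the entrywise absolute value. The matrix $\mathbf{Q_X}$ depends on $n$ and lies in $O(p,q)$. *)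

theory Defs
  imports
    "HOL-Probability.Probability"
    "Jordan_Normal_Form.Matrix"
    "Jordan_Normal_Form.DL_Rank"
begin

hide_type (open) Finite_Cartesian_Product.vec
hide_const (open) Finite_Cartesian_Product.vec Finite_Cartesian_Product.mat
no_notation Finite_Cartesian_Product.vec_nth (infixl "$" 90)
no_notation Inner_Product.real_inner_class.inner (infixl "\<bullet>" 70)

text \<open>
  The types of vectors and matrices used here carry no topology. The Borel sigma-algebras on
  \<open>\<real>\<^sup>d\<close> and on real \<open>nr \<times> nc\<close> matrices are therefore pulled back along the coordinates from
  the product sigma-algebra.
\<close>

definition borel_vec :: "nat \<Rightarrow> real vec measure" where
  "borel_vec d = vimage_algebra (carrier_vec d)
     (\<lambda>v. \<lambda>i\<in>{..<d}. v $ i) (\<Pi>\<^sub>M i\<in>{..<d}. borel)"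

definition borel_mat :: "nat \<Rightarrow> nat \<Rightarrow> real mat measure" where
  "borel_mat nr nc = vimage_algebra (carrier_mat nr nc)
     (\<lambda>A. \<lambda>ij\<in>{..<nr} \<times> {..<nc}. A $$ ij) (\<Pi>\<^sub>M ij\<in>{..<nr} \<times> {..<nc}. borel)"

text \<open>The operator norm induced by the Euclidean norms; using the closed unit ball rather than
  the unit sphere gives the value 0 to matrices without columns.\<close>

definition spectral_norm :: "real mat \<Rightarrow> real" where
  "spectral_norm A =
     (SUP v\<in>{v \<in> carrier_vec (dim_col A). sqrt (v \<bullet> v) \<le> 1}. sqrt ((A *\<^sub>v v) \<bullet> (A *\<^sub>v v)))"

definition sig_mat :: "nat \<Rightarrow> nat \<Rightarrow> real mat" where
  "sig_mat p q = four_block_mat (1\<^sub>m p) (0\<^sub>m p q) (0\<^sub>m q p) (- 1\<^sub>m q)"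

definition orth_group :: "nat \<Rightarrow> real mat set" where
  "orth_group d = {Q \<in> carrier_mat d d. Q * Q\<^sup>T = 1\<^sub>m d}"

definition indef_orth_group :: "nat \<Rightarrow> nat \<Rightarrow> real mat set" where
  "indef_orth_group p q =
     {Q \<in> carrier_mat (p + q) (p + q). Q * sig_mat p q * Q\<^sup>T = sig_mat p q}"

definition gen_inner_product_distr :: "nat \<Rightarrow> nat \<Rightarrow> real vec measure \<Rightarrow> bool" where
  "gen_inner_product_distr p q F \<longleftrightarrow>
     prob_space F \<and> sets F = sets (borel_vec (p + q)) \<and>
     (\<exists>\<Omega> \<subseteq> carrier_vec (p + q).
        (\<forall>x\<in>\<Omega>. \<forall>y\<in>\<Omega>. x \<bullet> (sig_mat p q *\<^sub>v y) \<in> {0..1}) \<and> (AE x in F. x \<in> \<Omega>))"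

text \<open>Existence of the moments is a separate condition, since the Bochner integral of a
  non-integrable function is 0.\<close>

definition finite_second_moments :: "nat \<Rightarrow> real vec measure \<Rightarrow> bool" where
  "finite_second_moments d F \<longleftrightarrow> (\<forall>j<d. \<forall>k<d. integrable F (\<lambda>x. x $ j * x $ k))"

definition second_moment_mat :: "nat \<Rightarrow> real vec measure \<Rightarrow> real mat" where
  "second_moment_mat d F = mat d d (\<lambda>(j, k). \<integral>x. x $ j * x $ k \<partial>F)"

definition data_mat :: "nat \<Rightarrow> (nat \<Rightarrow> real vec) \<Rightarrow> nat \<Rightarrow> real mat" where
  "data_mat d x n = mat_of_rows d (map x [0..<n])"

text \<open>Since \<open>U\<close> has orthonormal columns and the diagonal of \<open>L\<close> has no zero entry, the diagonal
  lists all nonzero eigenvalues of \<open>P\<close> with multiplicity; in particular \<open>P\<close> has rank \<open>d\<close>.\<close>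

definition nonzero_eigendecomp :: "nat \<Rightarrow> nat \<Rightarrow> real mat \<Rightarrow> real mat \<Rightarrow> real mat \<Rightarrow> bool" where
  "nonzero_eigendecomp n d P U L \<longleftrightarrow>
     U \<in> carrier_mat n d \<and> U\<^sup>T * U = 1\<^sub>m d \<and>
     L \<in> carrier_mat d d \<and> diagonal_mat L \<and>
     (\<forall>i<d. L $$ (i, i) \<noteq> 0) \<and> (\<forall>i j. i < j \<longrightarrow> j < d \<longrightarrow> L $$ (j, j) \<le> L $$ (i, i)) \<and>
     P = U * L * U\<^sup>T"

text \<open>For diagonal \<open>L\<close> this is \<open>|L|\<^bsup>1/2\<^esup>\<close>.\<close>

definition sqrt_abs_mat :: "real mat \<Rightarrow> real mat" where
  "sqrt_abs_mat L = map_mat (\<lambda>x. sqrt \<bar>x\<bar>) L"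

end

theory Submission
  imports Defs
begin

text \<open>
  Write \<open>I\<close> for the signature matrix and \<open>S\<^sub>n = X\<^sup>T X / n\<close>. The defining relation of \<open>Q = Q\<^sub>X\<close>,
  together with Sylvester's law of inertia, says that \<open>Q I Q\<^sup>T = I\<close> and \<open>S\<^sub>n = Q\<^sup>T D Q\<close> with
  \<open>D = |\<Lambda>| / n\<close> diagonal and positive. For a given \<open>S\<close>, two such factors \<open>Q\<close> differ by an element
  of \<open>O(d) \<inter> O(p,q)\<close>. When \<open>S\<^sub>n\<close> tends to the invertible matrix \<open>\<Delta>\<close>, the factors \<open>Q\<close> stay
  bounded and every limit point is a factor of \<open>\<Delta>\<close>; hence, with \<open>Q'\<close> any fixed factor of \<open>\<Delta>\<close>,
  the distance from \<open>Q'\<close> to the orbit of \<open>Q\<^sub>X\<close> under \<open>O(d) \<inter> O(p,q)\<close> tends to zero. Existence of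
  \<open>Q'\<close> is obtained from the limit points of a single outcome. The rotations \<open>W\<^sub>n\<close> are
  near-minimizers of the distance, selected measurably from a countable dense set. Almost sure
  convergence \<open>S\<^sub>n \<rightarrow> \<Delta>\<close> follows from Hoeffding's inequality, since invertibility of \<open>\<Delta>\<close>
  forces a generalized inner product distribution to have bounded support.
\<close>

section \<open>Pseudo-orthogonal factorizations\<close>

definition sig_sgn :: "nat \<Rightarrow> nat \<Rightarrow> real" where
  "sig_sgn p i = (if i < p then 1 else -1)"

lemma sig_sgn_mult_self [simp]: "sig_sgn p i * sig_sgn p i = 1"
  by (simp add: sig_sgn_def)

lemma sig_mat_eq_mat_diag: "sig_mat p q = mat_diag (p + q) (sig_sgn p)"
  by (rule eq_matI) (auto simp: sig_mat_def mat_diag_def sig_sgn_def)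

lemma sig_mat_carrier [simp]: "sig_mat p q \<in> carrier_mat (p + q) (p + q)"
  by (simp add: sig_mat_eq_mat_diag)

lemma sig_mat_squared [simp]: "sig_mat p q * sig_mat p q = 1\<^sub>m (p + q)"
  by (simp add: sig_mat_eq_mat_diag)

lemma transpose_mat_diag [simp]: "(mat_diag n f)\<^sup>T = mat_diag n f"
  by (rule eq_matI) (auto simp: mat_diag_def)

lemma transpose_sig_mat [simp]: "(sig_mat p q)\<^sup>T = sig_mat p q"
  by (simp add: sig_mat_eq_mat_diag)

lemma det_mat_diag: "det (mat_diag n f) = (\<Prod>i<n. f i)"
proof -
  have "det (mat_diag n f) = prod_list (diag_mat (mat_diag n f))"
    by (rule det_upper_triangular[of _ n]) (auto simp: mat_diag_def upper_triangular_def)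
  also have "diag_mat (mat_diag n f) = map f [0..<n]"
    by (auto simp: diag_mat_def mat_diag_def)
  finally show ?thesis
    by (simp add: prod.list_conv_set_nth atLeast0LessThan)
qed

lemma indef_orth_groupD:
  assumes "Q \<in> indef_orth_group p q"
  shows "Q \<in> carrier_mat (p + q) (p + q)" "Q * sig_mat p q * Q\<^sup>T = sig_mat p q"
  using assms by (auto simp: indef_orth_group_def)

text \<open>The relation exhibits \<open>?I * Q\<^sup>T * ?I\<close> as a right inverse of
  \<open>Q\<close>. For square matrices it is a left inverse as well, and cancelling one factor
  \<open>?I\<close> gives the transposed relation.\<close>

lemma indef_orth_group_transpose_mult:
  assumes "Q \<in> indef_orth_group p q"
  shows "Q\<^sup>T * sig_mat p q * Q = sig_mat p q"
proof -
  let ?d = "p + q" and ?I = "sig_mat p q"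
  note [simp] = indef_orth_groupD(1)[OF assms]
  note [simp] = mult_carrier_mat[of _ ?d ?d _ ?d]
    left_mult_one_mat[of _ ?d ?d] right_mult_one_mat[of _ ?d ?d]
  have c: "?I * Q\<^sup>T * ?I \<in> carrier_mat ?d ?d" by simp
  have "Q * (?I * Q\<^sup>T * ?I) = (Q * ?I * Q\<^sup>T) * ?I"
    by (simp add: assoc_mult_mat[of _ ?d ?d _ ?d _ ?d])
  also have "\<dots> = 1\<^sub>m ?d" by (simp add: indef_orth_groupD(2)[OF assms])
  finally have "(?I * Q\<^sup>T * ?I) * Q = 1\<^sub>m ?d"
    using mat_mult_left_right_inverse[OF indef_orth_groupD(1)[OF assms] c] by simp
  then have "?I * ((?I * Q\<^sup>T * ?I) * Q) = ?I"
    by (simp only: right_mult_one_mat[OF sig_mat_carrier])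
  moreover have "?I * ((?I * Q\<^sup>T * ?I) * Q) = (?I * ?I) * (Q\<^sup>T * ?I * Q)"
    by (simp add: assoc_mult_mat[of _ ?d ?d _ ?d _ ?d] mult_carrier_mat[of _ ?d ?d _ ?d]
    left_mult_one_mat[of _ ?d ?d] right_mult_one_mat[of _ ?d ?d]
        del: sig_mat_squared)
  ultimately show ?thesis
    by (simp add:)
qed


lemma indef_orth_group_det_nonzero:
  assumes "Q \<in> indef_orth_group p q"
  shows "det Q \<noteq> 0"
proof -
  let ?d = "p + q" and ?I = "sig_mat p q"
  note [simp] = indef_orth_groupD(1)[OF assms] mult_carrier_mat[of _ ?d ?d _ ?d]
    left_mult_one_mat[of _ ?d ?d] right_mult_one_mat[of _ ?d ?d]
  have "det (Q * ?I * Q\<^sup>T) = det Q * det ?I * det Q"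
    by (simp add: det_mult[of _ ?d] det_transpose[of _ ?d])
  moreover have "det ?I \<noteq> 0"
    by (simp add: sig_mat_eq_mat_diag det_mat_diag sig_sgn_def)
  ultimately show ?thesis
    using indef_orth_groupD(2)[OF assms] by auto
qed

lemma orth_indef_orth_group_carrier:
  "R \<in> orth_group (p + q) \<inter> indef_orth_group p q \<Longrightarrow> R \<in> carrier_mat (p + q) (p + q)"
  by (simp add: indef_orth_group_def)

text \<open>By pseudo-orthogonality \<open>S * sig_mat p q\<close> is similar to
  \<open>mat_diag (p + q) l * sig_mat p q\<close>, so the \<open>l i\<close> are the absolute values
  of its eigenvalues.\<close>

definition pseudo_polar :: "nat \<Rightarrow> nat \<Rightarrow> real mat \<Rightarrow> real mat \<Rightarrow> (nat \<Rightarrow> real) \<Rightarrow> bool" where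
  "pseudo_polar p q S Q l \<longleftrightarrow>
     Q \<in> indef_orth_group p q \<and> (\<forall>i<p + q. l i > 0) \<and> S = Q\<^sup>T * mat_diag (p + q) l * Q"

text \<open>The equation \<open>R\<^sup>T D' R = D\<close> becomes \<open>D' R = I R I D\<close> by pseudo-orthogonality, which
  for positive \<open>D\<close> and \<open>D'\<close> forces the off-diagonal blocks of \<open>R\<close> to vanish.\<close>

lemma indef_orth_group_congruence_orth:
  assumes R: "R \<in> indef_orth_group p q"
    and pos: "\<And>i. i < p + q \<Longrightarrow> l i > 0" "\<And>i. i < p + q \<Longrightarrow> l' i > 0"
    and eq: "R\<^sup>T * mat_diag (p + q) l' * R = mat_diag (p + q) l"
  shows "R \<in> orth_group (p + q)"
proof -
  let ?d = "p + q" and ?I = "sig_mat p q"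
  let ?D = "mat_diag ?d l" and ?D' = "mat_diag ?d l'"
  note [simp] = indef_orth_groupD(1)[OF R] mult_carrier_mat[of _ ?d ?d _ ?d]
    left_mult_one_mat[of _ ?d ?d] right_mult_one_mat[of _ ?d ?d]
  note assoc = assoc_mult_mat[of _ ?d ?d _ ?d _ ?d]
  have "?I * R * ?I * (R\<^sup>T * ?D' * R) = ?I * (R * ?I * R\<^sup>T) * ?D' * R"
    by (simp add: assoc)
  also have "\<dots> = ?D' * R"
    by (simp add: indef_orth_groupD(2)[OF R])
  finally have comm: "?D' * R = ?I * R * ?I * ?D"
    using eq by simp
  have "R $$ (i, j) = 0" if ij: "i < ?d" "j < ?d" "sig_sgn p i \<noteq> sig_sgn p j" for i j
  proof -
    have dims: "dim_row R = ?d" "dim_col R = ?d"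
      using carrier_matD[OF indef_orth_groupD(1)[OF R]] by auto
    have "l' i * R $$ (i, j) = (?D' * R) $$ (i, j)"
      using ij by (simp add: mat_diag_mult_left[of _ ?d ?d])
    also have "\<dots> = sig_sgn p i * R $$ (i, j) * sig_sgn p j * l j"
      unfolding comm using ij
      by (simp add: sig_mat_eq_mat_diag mat_diag_mult_left[of _ ?d ?d] mat_diag_mult_right[of _ ?d ?d])
    also have "\<dots> = - l j * R $$ (i, j)"
      using ij by (auto simp: sig_sgn_def split: if_splits)
    finally have "(l' i + l j) * R $$ (i, j) = 0"
      by (simp add: algebra_simps)
    moreover have "l' i + l j > 0" using pos ij by (simp add: add_pos_pos)
    ultimately show ?thesis by auto
  qed
  \<comment> \<open>With the off-diagonal blocks gone, \<open>R\<close> commutes with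
    \<open>?I\<close>, which can then be cancelled from
    \<open>R * ?I * R\<^sup>T = ?I\<close>.\<close>
  then have RI: "R * ?I = ?I * R"
    using indef_orth_groupD(1)[OF R] unfolding sig_mat_eq_mat_diag
    by (intro eq_matI) (force simp: mat_diag_mult_left[of _ ?d ?d] mat_diag_mult_right[of _ ?d ?d])+
  have "R * R\<^sup>T = ?I * ?I * R * R\<^sup>T" by simp
  also have "\<dots> = ?I * (?I * R) * R\<^sup>T" by (simp add: assoc del: sig_mat_squared)
  also have "\<dots> = ?I * (R * ?I * R\<^sup>T)" by (simp add: assoc flip: RI)
  also have "\<dots> = 1\<^sub>m ?d" by (simp add: indef_orth_groupD(2)[OF R])
  finally show ?thesis
    by (simp add: orth_group_def)
qed

text \<open>The transition matrix \<open>Q' * V\<close>, with \<open>V\<close> the inverse of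
  \<open>Q\<close>, is again pseudo-orthogonal and relates the two positive diagonals by congruence,
  so the preceding lemma makes it orthogonal too.\<close>

lemma pseudo_polar_unique:
  assumes "pseudo_polar p q S Q l" "pseudo_polar p q S Q' l'"
  obtains R where "R \<in> orth_group (p + q) \<inter> indef_orth_group p q" "R * Q = Q'"
proof -
  let ?d = "p + q" and ?I = "sig_mat p q"
  have Q: "Q \<in> indef_orth_group p q" and Q': "Q' \<in> indef_orth_group p q"
    and pos: "\<forall>i<?d. l i > 0" "\<forall>i<?d. l' i > 0"
    and S: "Q\<^sup>T * mat_diag ?d l * Q = Q'\<^sup>T * mat_diag ?d l' * Q'"
    using assms by (auto simp: pseudo_polar_def)
  note [simp] = indef_orth_groupD(1)[OF Q] indef_orth_groupD(1)[OF Q'] mult_carrier_mat[of _ ?d ?d _ ?d]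
    left_mult_one_mat[of _ ?d ?d] right_mult_one_mat[of _ ?d ?d]
  note assoc = assoc_mult_mat[of _ ?d ?d _ ?d _ ?d]
  define V where "V = ?I * Q\<^sup>T * ?I"
  have V [simp]: "V \<in> carrier_mat ?d ?d" by (simp add: V_def)
  have "V * Q = ?I * (Q\<^sup>T * ?I * Q)" by (simp add: V_def assoc)
  then have VQ: "V * Q = 1\<^sub>m ?d" by (simp add: indef_orth_group_transpose_mult[OF Q])
  have "Q * V = (Q * ?I * Q\<^sup>T) * ?I" by (simp add: V_def assoc)
  then have QV: "Q * V = 1\<^sub>m ?d" by (simp add: indef_orth_groupD(2)[OF Q])
  have tr: "(A * B)\<^sup>T = B\<^sup>T * A\<^sup>T" if "A \<in> carrier_mat ?d ?d" "B \<in> carrier_mat ?d ?d" for A B :: "real mat"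
    using that by (rule transpose_mult)
  have VT: "V\<^sup>T = ?I * Q * ?I" by (simp add: V_def tr assoc)
  have VIV: "V * ?I * V\<^sup>T = ?I"
  proof -
    have "V * ?I * V\<^sup>T = ?I * Q\<^sup>T * (?I * ?I) * (?I * Q * ?I)"
      unfolding VT by (simp add: V_def assoc del: sig_mat_squared)
    also have "\<dots> = ?I * (Q\<^sup>T * ?I * Q) * ?I" by (simp add: assoc)
    finally show ?thesis by (simp add: indef_orth_group_transpose_mult[OF Q])
  qed
  define R where "R = Q' * V"
  have R [simp]: "R \<in> carrier_mat ?d ?d" by (simp add: R_def)
  have "R * ?I * R\<^sup>T = Q' * (V * ?I * V\<^sup>T) * Q'\<^sup>T" by (simp add: R_def tr assoc)
  then have RG: "R \<in> indef_orth_group p q"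
    by (simp add: VIV indef_orth_groupD(2)[OF Q'] indef_orth_group_def)
  have "R\<^sup>T * mat_diag ?d l' * R = V\<^sup>T * (Q'\<^sup>T * mat_diag ?d l' * Q') * V"
    by (simp add: R_def tr assoc)
  also have "\<dots> = (Q * V)\<^sup>T * mat_diag ?d l * (Q * V)"
    by (simp flip: S add: tr[of Q V] assoc)
  also have "\<dots> = mat_diag ?d l" by (simp add: QV)
  finally have "R \<in> orth_group ?d"
    using pos by (intro indef_orth_group_congruence_orth[OF RG, of l l']) auto
  moreover have "R * Q = Q'" by (simp add: R_def assoc VQ)
  ultimately show ?thesis using that RG by blast
qed

section \<open>Sylvester's law of inertia\<close>

text \<open>Zero rows pad the equations to a square system; its last row vanishes, so the
  determinant is zero and the kernel nontrivial.\<close>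

lemma underdetermined_system_nontrivial:
  fixes cs :: "real vec list"
  assumes "length cs < d"
  obtains v where "v \<in> carrier_vec d" "v \<noteq> 0\<^sub>v d"
    "\<And>c. c \<in> set cs \<Longrightarrow> (\<Sum>j<d. c $ j * v $ j) = 0"
proof -
  define N where "N = mat d d (\<lambda>(i, j). if i < length cs then cs ! i $ j else 0)"
  have N [simp]: "N \<in> carrier_mat d d" by (simp add: N_def)
  have "N\<^sup>T *\<^sub>v unit_vec d (d - 1) = 0\<^sub>v d"
    using assms by (intro eq_vecI) (auto simp: N_def)
  moreover have "unit_vec d (d - 1) \<noteq> (0\<^sub>v d :: real vec)"
    using assms by (metis diff_less index_unit_vec(1) index_zero_vec(1) less_nat_zero_code
        linorder_neqE_nat zero_less_one zero_neq_one)
  ultimately have "det N\<^sup>T = 0"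
    by (subst det_0_iff_vec_prod_zero[of _ d]) (auto intro!: exI[of _ "unit_vec d (d - 1)"])
  then have "det N = 0" by (simp add: det_transpose[of _ d])
  then obtain v where v: "v \<in> carrier_vec d" "v \<noteq> 0\<^sub>v d" "N *\<^sub>v v = 0\<^sub>v d"
    by (subst (asm) det_0_iff_vec_prod_zero[of _ d]) auto
  have "(\<Sum>j<d. c $ j * v $ j) = 0" if c: "c \<in> set cs" for c
  proof -
    obtain i where i: "i < length cs" "c = cs ! i"
      using c by (auto simp: in_set_conv_nth)
    have "(N *\<^sub>v v) $ i = (\<Sum>j<d. c $ j * v $ j)"
      using i assms v(1) by (auto simp: N_def scalar_prod_def atLeast0LessThan)
    then show ?thesis using i assms v(3) by simp
  qed
  then show ?thesis using that v by blast
qed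

text \<open>One inequality of Sylvester's law. If \<open>b\<close> had more positive entries than
  \<open>a\<close>, some nonzero \<open>v\<close> would be supported where \<open>b\<close> is
  positive while \<open>Q\<^sup>T v\<close> vanishes where \<open>a\<close> is positive; the common
  quadratic form would be both positive and nonpositive at \<open>v\<close>.\<close>

lemma congruence_card_pos_le:
  assumes Q: "Q \<in> carrier_mat d d" and eq: "Q * mat_diag d a * Q\<^sup>T = mat_diag d (b :: nat \<Rightarrow> real)"
  shows "card {i. i < d \<and> b i > 0} \<le> card {i. i < d \<and> a i > 0}"
proof (rule ccontr)
  assume less: "\<not> ?thesis"
  \<comment> \<open>One equation for each index with \<open>b i \<le> 0\<close> and one for each
    with \<open>a k > 0\<close>; the assumption \<open>less\<close> makes these fewer than
    \<open>d\<close>.\<close>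
  define cs where "cs = map (unit_vec d) (filter (\<lambda>i. b i \<le> 0) [0..<d]) @
    map (\<lambda>k. vec d (\<lambda>i. Q $$ (i, k))) (filter (\<lambda>k. a k > 0) [0..<d])"
  have len: "length (filter P [0..<d]) = card {i. i < d \<and> P i}" for P
    by (simp add: length_filter_conv_card) (metis (no_types, lifting) nth_upt add_0 Collect_cong)
  have "card {i. i < d \<and> b i \<le> 0} + card {i. i < d \<and> b i > 0} = d"
    by (subst card_Un_disjoint[symmetric]) (auto intro!: arg_cong[where f = card, of _ "{..<d}", simplified])
  then have "length cs < d"
    using less by (simp add: cs_def len)
  then obtain v where v: "v \<in> carrier_vec d" "v \<noteq> 0\<^sub>v d"
    and orth: "\<And>c. c \<in> set cs \<Longrightarrow> (\<Sum>j<d. c $ j * v $ j) = 0"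
    by (rule underdetermined_system_nontrivial) blast
  have v0: "v $ i = 0" if "i < d" "b i \<le> 0" for i
  proof -
    have "(\<Sum>j<d. unit_vec d i $ j * v $ j) = (\<Sum>j<d. if j = i then v $ j else 0)"
      using that by (intro sum.cong) auto
    then show ?thesis
      using orth[of "unit_vec d i"] that by (auto simp: cs_def)
  qed
  have Qv0: "(\<Sum>i<d. Q $$ (i, k) * v $ i) = 0" if "k < d" "a k > 0" for k
    using orth[of "vec d (\<lambda>i. Q $$ (i, k))"] that by (auto simp: cs_def)
  obtain i0 where i0: "i0 < d" "v $ i0 \<noteq> 0"
    using v by (metis carrier_vecD eq_vecI index_zero_vec)
  have entry: "(\<Sum>k<d. Q $$ (i, k) * a k * Q $$ (j, k)) = (if i = j then b i else 0)"
    if "i < d" "j < d" for i j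
  proof -
    have "(Q * mat_diag d a * Q\<^sup>T) $$ (i, j) = (\<Sum>k<d. Q $$ (i, k) * a k * Q $$ (j, k))"
      using that Q by (auto simp: mat_diag_mult_right[of _ d d] scalar_prod_def atLeast0LessThan)
    then show ?thesis using that unfolding eq by (auto simp: mat_diag_def)
  qed
  \<comment> \<open>The form is expanded through the entries of
    \<open>Q * mat_diag d a * Q\<^sup>T\<close>; moving the sum over \<open>k\<close> outermost
    exposes squares weighted by \<open>a\<close>.\<close>
  have "(\<Sum>i<d. b i * (v $ i)\<^sup>2) = (\<Sum>i<d. \<Sum>j<d. v $ i * v $ j * (if i = j then b i else 0))"
    by (intro sum.cong) (auto simp: power2_eq_square if_distrib cong: if_cong)
  also have "\<dots> = (\<Sum>i<d. \<Sum>j<d. \<Sum>k<d. v $ i * v $ j * (Q $$ (i, k) * a k * Q $$ (j, k)))"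
    by (intro sum.cong refl) (simp add: entry flip: sum_distrib_left)
  also have "\<dots> = (\<Sum>i<d. \<Sum>k<d. \<Sum>j<d. v $ i * v $ j * (Q $$ (i, k) * a k * Q $$ (j, k)))"
    by (intro sum.cong refl sum.swap)
  also have "\<dots> = (\<Sum>k<d. \<Sum>i<d. \<Sum>j<d. v $ i * v $ j * (Q $$ (i, k) * a k * Q $$ (j, k)))"
    by (rule sum.swap)
  also have "\<dots> = (\<Sum>k<d. a k * (\<Sum>i<d. Q $$ (i, k) * v $ i)\<^sup>2)"
    by (intro sum.cong refl) (simp add: power2_eq_square sum_product sum_distrib_left mult_ac)
  also have "\<dots> \<le> 0"
  proof (intro sum_nonpos)
    fix k assume "k \<in> {..<d}"
    then show "a k * (\<Sum>i<d. Q $$ (i, k) * v $ i)\<^sup>2 \<le> 0"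
      using Qv0[of k] by (cases "a k > 0") (auto simp: mult_le_0_iff)
  qed
  finally have "(\<Sum>i<d. b i * (v $ i)\<^sup>2) \<le> 0" .
  moreover have "(\<Sum>i<d. b i * (v $ i)\<^sup>2) > 0"
  proof (rule sum_pos2)
    show "b i0 * (v $ i0)\<^sup>2 > 0"
      using i0 v0[of i0] by (cases "b i0 \<le> 0") auto
    show "b i * (v $ i)\<^sup>2 \<ge> 0" if "i \<in> {..<d}" for i
      using that v0[of i] by (cases "b i \<le> 0") auto
  qed (use i0 in auto)
  ultimately show False by simp
qed

text \<open>Inertia allows at most \<open>p\<close> positive and at most \<open>q\<close> negative
  values. In decreasing order, a negative value at an index below \<open>p\<close> would be followed
  by too many negative ones, and a positive value at an index from \<open>p\<close> on would be
  preceded by too many positive ones.\<close>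

lemma sorted_congruent_to_signature:
  assumes Q: "Q \<in> carrier_mat (p + q) (p + q)"
    and eq: "Q * sig_mat p q * Q\<^sup>T = mat_diag (p + q) (\<lambda>i. sgn (l i))"
    and nz: "\<And>i. i < p + q \<Longrightarrow> l i \<noteq> (0 :: real)"
    and dec: "\<And>i j. i < j \<Longrightarrow> j < p + q \<Longrightarrow> l j \<le> l i"
    and i: "i < p + q"
  shows "sgn (l i) = sig_sgn p i"
proof -
  let ?d = "p + q"
  note [simp] = Q mult_carrier_mat[of _ ?d ?d _ ?d]
  have "card {i. i < ?d \<and> sgn (l i) > 0} \<le> card {i. i < ?d \<and> sig_sgn p i > 0}"
    using eq unfolding sig_mat_eq_mat_diag by (rule congruence_card_pos_le[OF Q])
  also have "{i. i < ?d \<and> sig_sgn p i > 0} = {..<p}" by (auto simp: sig_sgn_def)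
  finally have pos: "card {i. i < ?d \<and> l i > 0} \<le> p" by simp
  \<comment> \<open>Negating both diagonals preserves the congruence and turns the count of positive
    entries into one of negative entries.\<close>
  have neg_diag: "mat_diag ?d (\<lambda>i. - f i) = - mat_diag ?d f" for f :: "nat \<Rightarrow> real"
    by (rule eq_matI) (auto simp: mat_diag_def)
  have "Q * mat_diag ?d (\<lambda>i. - sig_sgn p i) * Q\<^sup>T = mat_diag ?d (\<lambda>i. - sgn (l i))"
    using eq by (simp add: neg_diag sig_mat_eq_mat_diag carrier_matD[OF Q] carrier_matD[OF mat_diag_dim])
  then have "card {i. i < ?d \<and> - sgn (l i) > 0} \<le> card {i. i < ?d \<and> - sig_sgn p i > 0}"
    by (rule congruence_card_pos_le[OF Q])
  also have "{i. i < ?d \<and> - sig_sgn p i > 0} = {p..<?d}" by (auto simp: sig_sgn_def)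
  finally have neg: "card {i. i < ?d \<and> l i < 0} \<le> q" by simp
  show ?thesis
  proof (cases "i < p")
    case True
    have "l i > 0"
    proof (rule ccontr)
      assume "\<not> l i > 0"
      then have "l i < 0" using nz[OF i] by simp
      then have "{i..<?d} \<subseteq> {i. i < ?d \<and> l i < 0}"
        using dec[of i] by (force simp: order_le_less[of i])
      then have "card {i..<?d} \<le> q"
        using neg card_mono[of "{i. i < ?d \<and> l i < 0}" "{i..<?d}"] by simp
      with True show False by simp
    qed
    then show ?thesis using True by (simp add: sig_sgn_def)
  next
    case False
    have "l i < 0"
    proof (rule ccontr)
      assume "\<not> l i < 0"
      then have "l i > 0" using nz[OF i] by simp
      then have "{..i} \<subseteq> {i. i < ?d \<and> l i > 0}"
        using dec[of _ i] i by (force simp: order_le_less[of _ i])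
      then have "card {..i} \<le> p"
        using pos card_mono[of "{i. i < ?d \<and> l i > 0}" "{..i}"] by simp
      with False show False by simp
    qed
    then show ?thesis using False by (simp add: sig_sgn_def)
  qed
qed

text \<open>Cancelling \<open>U\<close> from the two expressions for
  \<open>X * sig_mat p q * X\<^sup>T\<close> shows that \<open>Q * sig_mat p q * Q\<^sup>T\<close>
  is the diagonal of signs of \<open>L\<close>, which inertia and the order of \<open>L\<close>
  identify with the signature. The Gram matrix factors because the columns of \<open>U\<close> are
  orthonormal.\<close>

lemma eigendecomp_pseudo_polar:
  assumes X: "X \<in> carrier_mat n (p + q)"
    and ev: "nonzero_eigendecomp n (p + q) (X * sig_mat p q * X\<^sup>T) U L"
    and Q: "Q \<in> carrier_mat (p + q) (p + q)"
    and XQ: "U * sqrt_abs_mat L * Q = X"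
  shows "pseudo_polar p q (X\<^sup>T * X) Q (\<lambda>i. \<bar>L $$ (i, i)\<bar>)"
proof -
  let ?d = "p + q" and ?I = "sig_mat p q"
  have U [simp]: "U \<in> carrier_mat n ?d" and UU: "U\<^sup>T * U = 1\<^sub>m ?d"
    and L [simp]: "L \<in> carrier_mat ?d ?d" "diagonal_mat L"
    and nz: "\<And>i. i < ?d \<Longrightarrow> L $$ (i, i) \<noteq> 0"
    and dec: "\<And>i j. i < j \<Longrightarrow> j < ?d \<Longrightarrow> L $$ (j, j) \<le> L $$ (i, i)"
    and P: "X * ?I * X\<^sup>T = U * L * U\<^sup>T"
    using ev by (auto simp: nonzero_eigendecomp_def)
  define s where "s i = sqrt \<bar>L $$ (i, i)\<bar>" for i
  have s: "sqrt_abs_mat L = mat_diag ?d s"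
    using L(2) carrier_matD[OF L(1)] by (intro eq_matI) (auto simp: sqrt_abs_mat_def s_def mat_diag_def diagonal_mat_def)
  \<comment> \<open>Here \<open>S\<close> is the square root of the absolute eigenvalues, not the
    matrix being factored.\<close>
  define S where "S = mat_diag ?d s"
  have [simp]: "S \<in> carrier_mat ?d ?d" "S\<^sup>T = S" by (simp_all add: S_def)
  have X_eq: "X = U * S * Q" using XQ by (simp add: s S_def)
  note [simp] = Q mult_carrier_mat[of _ ?d ?d _ ?d] mult_carrier_mat[of _ n ?d _ ?d]
    mult_carrier_mat[of _ ?d n _ ?d] mult_carrier_mat[of _ ?d ?d _ n] mult_carrier_mat[of _ n ?d _ n]
    left_mult_one_mat[of _ ?d ?d] right_mult_one_mat[of _ ?d ?d]
  note assoc = assoc_mult_mat[of _ ?d ?d _ ?d _ ?d] assoc_mult_mat[of _ n ?d _ ?d _ ?d]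
    assoc_mult_mat[of _ ?d n _ ?d _ ?d] assoc_mult_mat[of _ ?d ?d _ ?d _ n]
    assoc_mult_mat[of _ n ?d _ ?d _ n] assoc_mult_mat[of _ ?d ?d _ n _ ?d]
    assoc_mult_mat[of _ ?d n _ ?d _ n]
  have XT: "X\<^sup>T = Q\<^sup>T * S * U\<^sup>T"
    by (simp add: X_eq transpose_mult[of _ n ?d _ ?d] transpose_mult[of _ ?d ?d _ ?d] assoc)
  have UUA: "U\<^sup>T * (U * A) = A" if "A \<in> carrier_mat ?d ?d" for A
    using that UU assoc_mult_mat[of "U\<^sup>T" ?d n U ?d A ?d] by simp
  have "S * (Q * ?I * Q\<^sup>T) * S = U\<^sup>T * (U * (S * (Q * ?I * Q\<^sup>T) * S * (U\<^sup>T * U)))"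
    by (simp add: UUA) (simp add: UU)
  also have "\<dots> = U\<^sup>T * (X * ?I * X\<^sup>T) * U"
    unfolding XT by (simp add: X_eq assoc assoc_mult_mat[of _ ?d n _ n _ ?d] assoc_mult_mat[of _ n ?d _ n _ ?d])
  also have "\<dots> = U\<^sup>T * (U * (L * (U\<^sup>T * U)))"
    unfolding P by (simp add: assoc assoc_mult_mat[of _ ?d n _ n _ ?d] assoc_mult_mat[of _ n ?d _ n _ ?d])
  also have "\<dots> = L" by (simp add: UUA) (simp add: UU)
  finally have SQS: "S * (Q * ?I * Q\<^sup>T) * S = L" .
  define C where "C = Q * ?I * Q\<^sup>T"
  have C [simp]: "C \<in> carrier_mat ?d ?d" by (simp add: C_def)
  \<comment> \<open>Entrywise, \<open>L\<close> is \<open>C\<close> scaled by the positive factors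
    \<open>s i\<close> and \<open>s j\<close>: off the diagonal both vanish, and on it
    \<open>s i * s i\<close> is the absolute value, which leaves the sign.\<close>
  have C_eq: "C = mat_diag ?d (\<lambda>i. sgn (L $$ (i, i)))"
  proof (rule eq_matI)
    fix i j assume "i < dim_row (mat_diag ?d (\<lambda>i. sgn (L $$ (i, i))))"
      "j < dim_col (mat_diag ?d (\<lambda>i. sgn (L $$ (i, i))))"
    then have ij: "i < ?d" "j < ?d" by (auto simp: mat_diag_def)
    have spos: "s i > 0" "s j > 0" using nz ij by (simp_all add: s_def)
    have L_eq: "L $$ (i, j) = s i * C $$ (i, j) * s j"
      unfolding SQS[symmetric] C_def[symmetric] using ij
      by (simp add: S_def mat_diag_mult_left[of _ ?d ?d] mat_diag_mult_right[of _ ?d ?d])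
    show "C $$ (i, j) = mat_diag ?d (\<lambda>i. sgn (L $$ (i, i))) $$ (i, j)"
    proof (cases "i = j")
      case True
      have "\<bar>L $$ (i, i)\<bar> * C $$ (i, i) = (s i * s i) * C $$ (i, i)"
        by (simp add: s_def)
      also have "\<dots> = \<bar>L $$ (i, i)\<bar> * sgn (L $$ (i, i))"
        using L_eq True by (simp add: mult_ac abs_mult_sgn)
      finally show ?thesis
        using True ij nz[OF ij(1)] by (simp add: mat_diag_def)
    next
      case False
      then have "L $$ (i, j) = 0"
        using L(2) carrier_matD[OF L(1)] ij by (auto simp: diagonal_mat_def)
      then show ?thesis using L_eq spos False ij by (simp add: mat_diag_def)
    qed
  qed (use carrier_matD[OF C] in \<open>auto simp: mat_diag_def\<close>)
  have "C = ?I"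
    unfolding C_eq sig_mat_eq_mat_diag
    using sorted_congruent_to_signature[OF Q C_eq[unfolded C_def] nz dec]
    by (intro eq_matI) (auto simp: mat_diag_def)
  then have "Q \<in> indef_orth_group p q"
    by (simp add: indef_orth_group_def C_def)
  moreover have "X\<^sup>T * X = Q\<^sup>T * mat_diag ?d (\<lambda>i. \<bar>L $$ (i, i)\<bar>) * Q"
  proof -
    have "X\<^sup>T * X = Q\<^sup>T * (S * (U\<^sup>T * (U * (S * Q))))"
      unfolding XT by (simp add: X_eq assoc assoc_mult_mat[of _ ?d ?d _ n _ ?d])
    also have "\<dots> = Q\<^sup>T * (S * S) * Q" by (simp add: UUA) (simp add: assoc)
    also have "S * S = mat_diag ?d (\<lambda>i. \<bar>L $$ (i, i)\<bar>)" by (simp add: S_def s_def)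
    finally show ?thesis .
  qed
  ultimately show ?thesis
    using nz by (simp add: pseudo_polar_def)
qed

section \<open>Limits of matrices and compactness\<close>

text \<open>The matrix type has no topology, so convergence is entrywise. Dimensions are not part of
  it, hence the separate carrier assumptions below.\<close>

definition mat_tendsto :: "nat \<Rightarrow> (nat \<Rightarrow> real mat) \<Rightarrow> real mat \<Rightarrow> bool" where
  "mat_tendsto d A A' \<longleftrightarrow> (\<forall>i<d. \<forall>j<d. (\<lambda>n. A n $$ (i, j)) \<longlonglongrightarrow> A' $$ (i, j))"

lemma mat_tendsto_const [simp]: "mat_tendsto d (\<lambda>n. A) A"
  by (simp add: mat_tendsto_def)

lemma mat_tendsto_transpose:
  assumes "mat_tendsto d A A'" "\<And>n. A n \<in> carrier_mat d d" "A' \<in> carrier_mat d d"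
  shows "mat_tendsto d (\<lambda>n. (A n)\<^sup>T) A'\<^sup>T"
  using assms(1) carrier_matD[OF assms(2)] carrier_matD[OF assms(3)] by (simp add: mat_tendsto_def)

lemma mat_tendsto_mult:
  assumes "mat_tendsto d A A'" "mat_tendsto d B B'"
    and "\<And>n. A n \<in> carrier_mat d d" "A' \<in> carrier_mat d d"
    and "\<And>n. B n \<in> carrier_mat d d" "B' \<in> carrier_mat d d"
  shows "mat_tendsto d (\<lambda>n. A n * B n) (A' * B')"
  unfolding mat_tendsto_def
proof safe
  fix i j assume ij: "i < d" "j < d"
  have entry: "(E * F) $$ (i, j) = (\<Sum>k<d. E $$ (i, k) * F $$ (k, j))"
    if "E \<in> carrier_mat d d" "F \<in> carrier_mat d d" for E F :: "real mat"
    using that ij by (simp add: scalar_prod_def atLeast0LessThan)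
  have "(\<lambda>n. \<Sum>k<d. A n $$ (i, k) * B n $$ (k, j)) \<longlonglongrightarrow> (\<Sum>k<d. A' $$ (i, k) * B' $$ (k, j))"
    using assms(1,2) ij by (intro tendsto_intros) (auto simp: mat_tendsto_def)
  then show "(\<lambda>n. (A n * B n) $$ (i, j)) \<longlonglongrightarrow> (A' * B') $$ (i, j)"
    by (simp add: entry assms)
qed

lemma mat_tendsto_subseq:
  "mat_tendsto d A A' \<Longrightarrow> strict_mono r \<Longrightarrow> mat_tendsto d (\<lambda>n. A (r n)) A'"
  unfolding mat_tendsto_def using LIMSEQ_subseq_LIMSEQ[unfolded o_def] by blast

lemma mat_tendsto_unique:
  assumes "mat_tendsto d A A'" "mat_tendsto d A A''" "A' \<in> carrier_mat d d" "A'' \<in> carrier_mat d d"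
  shows "A' = A''"
proof (rule eq_matI)
  show "A' $$ (i, j) = A'' $$ (i, j)" if "i < dim_row A''" "j < dim_col A''" for i j
    using that assms by (intro LIMSEQ_unique[of "\<lambda>n. A n $$ (i, j)"]) (auto simp: mat_tendsto_def)
qed (use assms in auto)

lemma tendsto_det:
  assumes "mat_tendsto d A A'" "\<And>n. A n \<in> carrier_mat d d" "A' \<in> carrier_mat d d"
  shows "(\<lambda>n. det (A n)) \<longlonglongrightarrow> det A'"
  unfolding det_def'[OF assms(2)] det_def'[OF assms(3)]
proof (intro tendsto_intros)
  fix \<pi> i assume "\<pi> \<in> {\<pi>. \<pi> permutes {0..<d}}" "i \<in> {0..<d}"
  then have "i < d" "\<pi> i < d" by (auto dest: permutes_in_image[of _ _ i])
  then show "(\<lambda>n. A n $$ (i, \<pi> i)) \<longlonglongrightarrow> A' $$ (i, \<pi> i)"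
    using assms(1) by (simp add: mat_tendsto_def)
qed

text \<open>The adjugate formula makes every entry of the inverse, up to sign, a quotient of
  determinants, so continuity of inversion reduces to that of determinants.\<close>

definition inv_mat :: "real mat \<Rightarrow> real mat" where
  "inv_mat A = inverse (det A) \<cdot>\<^sub>m adj_mat A"

lemma inv_mat:
  assumes "A \<in> carrier_mat d d" "det A \<noteq> 0"
  shows "inv_mat A \<in> carrier_mat d d" "A * inv_mat A = 1\<^sub>m d" "inv_mat A * A = 1\<^sub>m d"
proof -
  note adj = adj_mat[OF assms(1)]
  show "inv_mat A \<in> carrier_mat d d"
    using adj by (simp add: inv_mat_def)
  show "A * inv_mat A = 1\<^sub>m d" "inv_mat A * A = 1\<^sub>m d"
    using assms adj
    by (auto simp: inv_mat_def mult_smult_distrib[of _ d d _ d] mult_smult_assoc_mat[of _ d d _ d]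
        intro!: eq_matI)
qed

lemma mat_tendsto_inv_mat:
  assumes A: "mat_tendsto d A A'" and carr: "\<And>n. A n \<in> carrier_mat d d" "A' \<in> carrier_mat d d"
    and nz: "det A' \<noteq> 0"
  shows "mat_tendsto d (\<lambda>n. inv_mat (A n)) (inv_mat A')"
  unfolding mat_tendsto_def
proof safe
  fix i j assume ij: "i < d" "j < d"
  have entry: "inv_mat E $$ (i, j) = inverse (det E) * ((-1) ^ (j + i) * det (mat_delete E j i))"
    if "E \<in> carrier_mat d d" for E
    using that ij by (simp add: inv_mat_def adj_mat_def cofactor_def)
  have "(\<lambda>n. det (mat_delete (A n) j i)) \<longlonglongrightarrow> det (mat_delete A' j i)"
  proof (rule tendsto_det[of "d - 1"])
    have "mat_delete E j i $$ (a, b) = E $$ (if a < j then a else Suc a, if b < i then b else Suc b)"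
      if "E \<in> carrier_mat d d" "a < d - 1" "b < d - 1" for E :: "real mat" and a b
      using that by (simp add: mat_delete_def)
    then show "mat_tendsto (d - 1) (\<lambda>n. mat_delete (A n) j i) (mat_delete A' j i)"
      using A carr by (simp add: mat_tendsto_def)
  qed (use mat_delete_carrier[OF carr(1)] mat_delete_carrier[OF carr(2)] in auto)
  then have "(\<lambda>n. inverse (det (A n)) * ((-1) ^ (j + i) * det (mat_delete (A n) j i))) \<longlonglongrightarrow>
      inverse (det A') * ((-1) ^ (j + i) * det (mat_delete A' j i))"
    using tendsto_det[OF A carr] nz by (intro tendsto_intros)
  then show "(\<lambda>n. inv_mat (A n) $$ (i, j)) \<longlonglongrightarrow> inv_mat A' $$ (i, j)"
    by (simp add: entry carr)
qed

text \<open>Bolzano-Weierstrass, applied to one sequence of the family after another; further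
  thinning preserves the convergence already obtained.\<close>

lemma bounded_finite_family_convergent_subseq:
  fixes f :: "'i \<Rightarrow> nat \<Rightarrow> real"
  assumes "finite I" "\<And>i. i \<in> I \<Longrightarrow> bounded (range (f i))"
  obtains r where "strict_mono r" "\<And>i. i \<in> I \<Longrightarrow> convergent (\<lambda>n. f i (r n))"
  using assms
proof (induction I arbitrary: thesis rule: finite_induct)
  case empty
  then show ?case using strict_mono_id by blast
next
  case (insert i I)
  obtain r where r: "strict_mono r" "\<And>i. i \<in> I \<Longrightarrow> convergent (\<lambda>n. f i (r n))"
    using insert.IH insert.prems(2) by blast
  have "bounded (range (\<lambda>n. f i (r n)))"
    using insert.prems(2)[of i] by (auto intro: bounded_subset)
  then obtain x r' where r': "strict_mono r'" "(\<lambda>n. f i (r (r' n))) \<longlonglongrightarrow> x"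
    using bounded_imp_convergent_subsequence[of "\<lambda>n. f i (r n)"] by (auto simp: o_def)
  show ?case
  proof (rule insert.prems(1))
    show "strict_mono (\<lambda>n. r (r' n))"
      using r r' strict_mono_o[of r r'] by (simp add: o_def)
    show "convergent (\<lambda>n. f k (r (r' n)))" if "k \<in> insert i I" for k
    proof (cases "k = i")
      case True
      then show ?thesis using r'(2) by (auto simp: convergent_def)
    next
      case False
      then have "convergent (\<lambda>n. f k (r n))" using that r(2) by simp
      then show ?thesis
        using convergent_subseq_convergent[of "\<lambda>n. f k (r n)" r'] r'(1) by (simp add: o_def)
    qed
  qed
qed

section \<open>Boundedness and limit points of the factors\<close>

lemma pseudo_polar_det_nonzero:
  assumes "pseudo_polar p q S Q l"
  shows "det S \<noteq> 0"
proof -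
  let ?d = "p + q"
  have Q: "Q \<in> indef_orth_group p q" and pos: "\<forall>i<?d. l i > 0" and S: "S = Q\<^sup>T * mat_diag ?d l * Q"
    using assms by (auto simp: pseudo_polar_def)
  note [simp] = indef_orth_groupD(1)[OF Q] mult_carrier_mat[of _ ?d ?d _ ?d]
  have "det S = det Q * (\<Prod>i<?d. l i) * det Q"
    by (simp add: S det_mult[of _ ?d] det_transpose[of _ ?d] det_mat_diag)
  moreover have "(\<Prod>i<?d. l i) \<noteq> 0" using pos by auto
  ultimately show ?thesis using indef_orth_group_det_nonzero[OF Q] by simp
qed

lemma pseudo_polar_carrier:
  assumes "pseudo_polar p q S Q l"
  shows "S \<in> carrier_mat (p + q) (p + q)" "Q \<in> carrier_mat (p + q) (p + q)"
  using assms indef_orth_groupD(1)[of Q p q]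
  by (auto simp: pseudo_polar_def mult_carrier_mat[of _ "p + q" "p + q"])

text \<open>Since \<open>Q\<close> has inverse \<open>?I * Q\<^sup>T * ?I\<close> and diagonal
  matrices commute, the inverse of \<open>S\<close> has the same \<open>Q\<close> with reciprocal
  values, conjugated by \<open>?I\<close>.\<close>

lemma pseudo_polar_inverse:
  assumes "pseudo_polar p q S Q l"
  shows "inv_mat S = sig_mat p q * Q\<^sup>T * mat_diag (p + q) (\<lambda>i. 1 / l i) * Q * sig_mat p q"
proof -
  let ?d = "p + q" and ?I = "sig_mat p q"
  let ?E = "mat_diag ?d (\<lambda>i. 1 / l i)"
  have Q: "Q \<in> indef_orth_group p q" and pos: "\<forall>i<?d. l i > 0" and S: "S = Q\<^sup>T * mat_diag ?d l * Q"
    using assms by (auto simp: pseudo_polar_def)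
  note [simp] = indef_orth_groupD(1)[OF Q] mult_carrier_mat[of _ ?d ?d _ ?d]
    left_mult_one_mat[of _ ?d ?d] right_mult_one_mat[of _ ?d ?d]
  note assoc = assoc_mult_mat[of _ ?d ?d _ ?d _ ?d]
  note inv = inv_mat[OF pseudo_polar_carrier(1)[OF assms] pseudo_polar_det_nonzero[OF assms]]
  define Y where "Y = ?I * Q\<^sup>T * ?E * Q * ?I"
  have Y [simp]: "Y \<in> carrier_mat ?d ?d" by (simp add: Y_def)
  have comm: "mat_diag ?d l * ?I * ?E = ?I"
    using pos unfolding sig_mat_eq_mat_diag mat_diag_diag by (auto simp: mat_diag_def intro!: eq_matI)
  have "S * Y = Q\<^sup>T * mat_diag ?d l * (Q * ?I * Q\<^sup>T) * ?E * Q * ?I"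
    by (simp add: S Y_def assoc)
  also have "\<dots> = Q\<^sup>T * (mat_diag ?d l * ?I * ?E) * Q * ?I"
    by (simp add: indef_orth_groupD(2)[OF Q] assoc)
  also have "\<dots> = 1\<^sub>m ?d"
    by (simp add: comm indef_orth_group_transpose_mult[OF Q])
  finally have SY: "S * Y = 1\<^sub>m ?d" .
  have "inv_mat S = inv_mat S * (S * Y)"
    using inv by (simp add: SY)
  also have "\<dots> = (inv_mat S * S) * Y"
    using inv(1) pseudo_polar_carrier(1)[OF assms] by (simp add: assoc)
  also have "\<dots> = Y" using inv by simp
  finally show ?thesis by (simp add: Y_def)
qed

text \<open>Writing \<open>q\<^sub>i\<close> for the rows of \<open>Q\<close>, the diagonal entries of \<open>S\<close> and of its inverse are
  \<open>\<Sum>\<^sub>i l\<^sub>i q\<^sub>i\<^sub>j\<^sup>2\<close> and \<open>\<Sum>\<^sub>i q\<^sub>i\<^sub>j\<^sup>2 / l\<^sub>i\<close>, and \<open>l + 1 / l \<ge> 2\<close>.\<close>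

lemma pseudo_polar_entry_bound:
  assumes pp: "pseudo_polar p q S Q l" and ij: "i < p + q" "j < p + q"
  shows "2 * (Q $$ (i, j))\<^sup>2 \<le> S $$ (j, j) + inv_mat S $$ (j, j)"
proof -
  let ?d = "p + q"
  have Q: "Q \<in> indef_orth_group p q" and pos: "\<forall>i<?d. l i > 0" and S: "S = Q\<^sup>T * mat_diag ?d l * Q"
    using pp by (auto simp: pseudo_polar_def)
  note dims = carrier_matD[OF indef_orth_groupD(1)[OF Q]]
  note [simp] = indef_orth_groupD(1)[OF Q] mult_carrier_mat[of _ ?d ?d _ ?d]
  note assoc = assoc_mult_mat[of _ ?d ?d _ ?d _ ?d]
  have entry: "(Q\<^sup>T * mat_diag ?d f * Q) $$ (j, j) = (\<Sum>k<?d. f k * (Q $$ (k, j))\<^sup>2)" for f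
    using ij dims
    by (simp add: mat_diag_mult_right[of _ ?d ?d] scalar_prod_def atLeast0LessThan power2_eq_square mult_ac)
  have inv: "inv_mat S = sig_mat p q * (Q\<^sup>T * mat_diag ?d (\<lambda>i. 1 / l i) * Q) * sig_mat p q"
    using pseudo_polar_inverse[OF pp] by (simp add: assoc)
  have "(sig_mat p q * E * sig_mat p q) $$ (j, j) = E $$ (j, j)" if "E \<in> carrier_mat ?d ?d" for E
    using that ij(2) unfolding sig_mat_eq_mat_diag
    by (simp add: mat_diag_mult_left[of _ ?d ?d] mat_diag_mult_right[of _ ?d ?d] sig_sgn_def)
  then have "inv_mat S $$ (j, j) = (\<Sum>k<?d. 1 / l k * (Q $$ (k, j))\<^sup>2)"
    using entry by (simp add: inv)
  then have "S $$ (j, j) + inv_mat S $$ (j, j) = (\<Sum>k<?d. (l k + 1 / l k) * (Q $$ (k, j))\<^sup>2)"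
    by (simp add: S entry distrib_right sum.distrib)
  moreover have "\<dots> \<ge> (l i + 1 / l i) * (Q $$ (i, j))\<^sup>2"
    using ij pos by (intro member_le_sum[of i]) (auto intro!: mult_nonneg_nonneg add_nonneg_nonneg simp: less_imp_le)
  moreover have "2 * (Q $$ (i, j))\<^sup>2 \<le> (l i + 1 / l i) * (Q $$ (i, j))\<^sup>2"
  proof (rule mult_right_mono)
    have "0 \<le> (l i - 1)\<^sup>2 / l i" using pos ij by (simp add: less_imp_le)
    moreover have "(x - 1)\<^sup>2 / x = x + 1 / x - 2" if "x > 0" for x :: real
      using that by (simp add: power2_eq_square field_simps)
    ultimately show "2 \<le> l i + 1 / l i" using pos ij by simp
  qed simp
  ultimately show ?thesis by simp
qed

text \<open>Solving the factorization for \<open>l\<close> and its reciprocals makes both polynomial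
  in \<open>Q\<close>, \<open>S\<close> and \<open>inv_mat S\<close>, so convergence of these
  matrices passes to \<open>l\<close> and \<open>1 / l\<close>.\<close>

lemma pseudo_polar_spectrum:
  assumes "pseudo_polar p q S Q l"
  defines "I \<equiv> sig_mat p q"
  shows "mat_diag (p + q) l = I * Q * I * S * I * Q\<^sup>T * I"
    and "mat_diag (p + q) (\<lambda>i. 1 / l i) = Q * inv_mat S * Q\<^sup>T"
proof -
  let ?d = "p + q"
  have Q: "Q \<in> indef_orth_group p q" and S: "S = Q\<^sup>T * mat_diag ?d l * Q"
    using assms by (auto simp: pseudo_polar_def)
  have I [simp]: "I \<in> carrier_mat ?d ?d" "I * I = 1\<^sub>m ?d"
    and QIQ: "Q * I * Q\<^sup>T = I"
    using indef_orth_groupD(2)[OF Q] by (simp_all add: I_def)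
  note [simp] = indef_orth_groupD(1)[OF Q] mult_carrier_mat[of _ ?d ?d _ ?d]
    left_mult_one_mat[of _ ?d ?d] right_mult_one_mat[of _ ?d ?d]
  note assoc = assoc_mult_mat[of _ ?d ?d _ ?d _ ?d]
  have comm: "I * mat_diag ?d f * I = mat_diag ?d f" for f
    unfolding I_def sig_mat_eq_mat_diag mat_diag_diag
    by (auto simp: sig_sgn_def intro!: arg_cong[where f = "mat_diag ?d"])
  have "I * Q * I * S * I * Q\<^sup>T * I = I * (Q * I * Q\<^sup>T) * mat_diag ?d l * (Q * I * Q\<^sup>T) * I"
    by (simp add: S assoc)
  also have "\<dots> = mat_diag ?d l"
    unfolding QIQ by (simp add: assoc)
  finally show "mat_diag ?d l = I * Q * I * S * I * Q\<^sup>T * I" ..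
  have "Q * inv_mat S * Q\<^sup>T = (Q * I * Q\<^sup>T) * mat_diag ?d (\<lambda>i. 1 / l i) * (Q * I * Q\<^sup>T)"
    unfolding pseudo_polar_inverse[OF assms(1)] by (simp add: assoc flip: I_def)
  then show "mat_diag ?d (\<lambda>i. 1 / l i) = Q * inv_mat S * Q\<^sup>T"
    by (simp add: QIQ comm)
qed

text \<open>The entry bound confines the factors to a bounded set, and the equations defining a
  factorization survive limits. Positivity of the values survives because their reciprocals converge
  too.\<close>

lemma pseudo_polar_convergent_subseq:
  assumes pp: "\<And>n. pseudo_polar p q (S n) (Q n) (l n)"
    and S: "mat_tendsto (p + q) S S'" "S' \<in> carrier_mat (p + q) (p + q)" "det S' \<noteq> 0"
  obtains r Q' l' where "strict_mono r" "pseudo_polar p q S' Q' l'"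
    "mat_tendsto (p + q) (\<lambda>n. Q (r n)) Q'"
proof -
  let ?d = "p + q" and ?I = "sig_mat p q"
  note Qn = pp[unfolded pseudo_polar_def, THEN conjunct1]
  have pos: "l n i > 0" if "i < ?d" for n i
    using pp[of n] that by (simp add: pseudo_polar_def)
  have Sn: "S n = (Q n)\<^sup>T * mat_diag ?d (l n) * Q n" for n
    using pp[of n] by (simp add: pseudo_polar_def)
  have carr [simp]: "S n \<in> carrier_mat ?d ?d" "Q n \<in> carrier_mat ?d ?d"
    "inv_mat (S n) \<in> carrier_mat ?d ?d" for n
    using pseudo_polar_carrier[OF pp] pseudo_polar_det_nonzero[OF pp] inv_mat(1) by blast+
  have carr' [simp]: "inv_mat S' \<in> carrier_mat ?d ?d" using inv_mat(1) S by blast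
  have B: "mat_tendsto ?d (\<lambda>n. inv_mat (S n)) (inv_mat S')"
    using S by (intro mat_tendsto_inv_mat) auto
  have "bounded (range (\<lambda>n. Q n $$ ij))" if ij_in: "ij \<in> {..<?d} \<times> {..<?d}" for ij
  proof -
    obtain i j where ij: "ij = (i, j)" "i < ?d" "j < ?d" using ij_in by auto
    have "convergent (\<lambda>n. S n $$ (j, j) + inv_mat (S n) $$ (j, j))"
      using S(1) B ij unfolding mat_tendsto_def by (intro convergent_add) (unfold convergent_def, blast+)
    then obtain K where K: "\<And>n. \<bar>S n $$ (j, j) + inv_mat (S n) $$ (j, j)\<bar> \<le> K"
      using convergent_imp_Bseq[THEN BseqD] by fastforce
    have "\<bar>Q n $$ (i, j)\<bar> \<le> 1 + K" for n
    proof -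
      have "2 * (Q n $$ (i, j))\<^sup>2 \<le> K"
        using pseudo_polar_entry_bound[OF pp ij(2,3), of n] K[of n] by linarith
      \<comment> \<open>A bound on squares becomes a bound on absolute values through
        \<open>2 * t \<le> 1 + t\<^sup>2\<close>.\<close>
      moreover have "2 * \<bar>Q n $$ (i, j)\<bar> \<le> 1 + (Q n $$ (i, j))\<^sup>2"
        using zero_le_power2[of "\<bar>Q n $$ (i, j)\<bar> - 1"] by (simp add: power2_diff)
      ultimately show ?thesis using zero_le_power2[of "Q n $$ (i, j)"] by linarith
    qed
    then show ?thesis unfolding bounded_iff ij(1) by auto
  qed
  then obtain r where r: "strict_mono r"
    and conv: "\<And>ij. ij \<in> {..<?d} \<times> {..<?d} \<Longrightarrow> convergent (\<lambda>n. Q (r n) $$ ij)"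
    using bounded_finite_family_convergent_subseq[of "{..<?d} \<times> {..<?d}" "\<lambda>ij n. Q n $$ ij"] by auto
  define Q' where "Q' = mat ?d ?d (\<lambda>ij. lim (\<lambda>n. Q (r n) $$ ij))"
  have Q' [simp]: "Q' \<in> carrier_mat ?d ?d" by (simp add: Q'_def)
  have Qlim: "mat_tendsto ?d (\<lambda>n. Q (r n)) Q'"
    using conv by (auto simp: mat_tendsto_def Q'_def convergent_LIMSEQ_iff)
  have QTlim: "mat_tendsto ?d (\<lambda>n. (Q (r n))\<^sup>T) Q'\<^sup>T"
    by (rule mat_tendsto_transpose[OF Qlim]) simp_all
  have Slim: "mat_tendsto ?d (\<lambda>n. S (r n)) S'" and Blim: "mat_tendsto ?d (\<lambda>n. inv_mat (S (r n))) (inv_mat S')"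
    using mat_tendsto_subseq[OF S(1) r] mat_tendsto_subseq[OF B r] by auto
  note [simp] = mult_carrier_mat[of _ ?d ?d _ ?d] S(2)
  define E where "E = ?I * Q' * ?I * S' * ?I * Q'\<^sup>T * ?I"
  have E [simp]: "E \<in> carrier_mat ?d ?d" by (simp add: E_def)
  have Elim: "mat_tendsto ?d (\<lambda>n. mat_diag ?d (l (r n))) E"
    unfolding pseudo_polar_spectrum(1)[OF pp] E_def
    by (intro mat_tendsto_mult Qlim QTlim Slim) simp_all
  have invlim: "mat_tendsto ?d (\<lambda>n. mat_diag ?d (\<lambda>i. 1 / l (r n) i)) (Q' * inv_mat S' * Q'\<^sup>T)"
    unfolding pseudo_polar_spectrum(2)[OF pp] by (intro mat_tendsto_mult Qlim QTlim Blim) simp_all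
  define l' where "l' i = E $$ (i, i)" for i
  have l'lim: "(\<lambda>n. l (r n) i) \<longlonglongrightarrow> l' i" if "i < ?d" for i
    using Elim that unfolding mat_tendsto_def l'_def by (auto simp: mat_diag_def dest!: spec[of _ i])
  \<comment> \<open>Off the diagonal the approximating matrices are zero, so \<open>E\<close> is
    diagonal.\<close>
  have "E = mat_diag ?d l'"
    using l'lim by (intro mat_tendsto_unique[OF Elim]) (auto simp: mat_tendsto_def mat_diag_def)
  have "l' i > 0" if i: "i < ?d" for i
  proof -
    have "(\<lambda>n. 1 / l (r n) i) \<longlonglongrightarrow> (Q' * inv_mat S' * Q'\<^sup>T) $$ (i, i)"
      using invlim i by (auto simp: mat_tendsto_def mat_diag_def dest!: spec[of _ i])
    \<comment> \<open>The values times their reciprocals are constantly 1, so the limit of the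
      values cannot be 0.\<close>
    from tendsto_mult[OF l'lim[OF i] this]
    have "(\<lambda>n. 1) \<longlonglongrightarrow> l' i * (Q' * inv_mat S' * Q'\<^sup>T) $$ (i, i)"
      using pos[OF i] by (simp add: less_imp_neq[symmetric])
    then have "l' i \<noteq> 0" by (metis LIMSEQ_const_iff mult_zero_left zero_neq_one)
    moreover have "l' i \<ge> 0"
      using l'lim[OF i] by (rule LIMSEQ_le_const) (auto intro: less_imp_le[OF pos[OF i]])
    ultimately show ?thesis by simp
  qed
  moreover have "Q' \<in> indef_orth_group p q"
  proof -
    have "mat_tendsto ?d (\<lambda>n. Q (r n) * ?I * (Q (r n))\<^sup>T) (Q' * ?I * Q'\<^sup>T)"
      by (intro mat_tendsto_mult Qlim QTlim) simp_all
    then have "mat_tendsto ?d (\<lambda>n. ?I) (Q' * ?I * Q'\<^sup>T)"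
      by (simp add: indef_orth_groupD(2)[OF Qn])
    then have "Q' * ?I * Q'\<^sup>T = ?I" by (rule mat_tendsto_unique) simp_all
    then show ?thesis by (simp add: indef_orth_group_def)
  qed
  moreover have "S' = Q'\<^sup>T * mat_diag ?d l' * Q'"
  proof (rule mat_tendsto_unique[OF Slim])
    show "mat_tendsto ?d (\<lambda>n. S (r n)) (Q'\<^sup>T * mat_diag ?d l' * Q')"
      unfolding Sn \<open>E = mat_diag ?d l'\<close>[symmetric]
      by (intro mat_tendsto_mult Qlim QTlim Elim) simp_all
  qed simp_all
  ultimately have "pseudo_polar p q S' Q' l'" by (simp add: pseudo_polar_def)
  then show ?thesis using that r Qlim by blast
qed

section \<open>Distance to the orbit of a factor\<close>

text \<open>This l1 distance replaces the spectral norm of the difference: it dominates that norm by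
  \<open>spectral_norm_le_entries\<close>, and its continuity and measurability can be read off the
  entries.\<close>

definition entry_dist :: "nat \<Rightarrow> real mat \<Rightarrow> real mat \<Rightarrow> real" where
  "entry_dist d A B = (\<Sum>i<d. \<Sum>j<d. \<bar>A $$ (i, j) - B $$ (i, j)\<bar>)"

lemma entry_dist_nonneg [simp]: "entry_dist d A B \<ge> 0"
  by (simp add: entry_dist_def sum_nonneg)

lemma entry_dist_tendsto:
  assumes "mat_tendsto d A A'"
  shows "(\<lambda>n. entry_dist d (A n) B) \<longlonglongrightarrow> entry_dist d A' B"
  using assms unfolding entry_dist_def mat_tendsto_def by (intro tendsto_intros) auto

text \<open>Otherwise the orbits of infinitely many factors stay away from \<open>Qt\<close>. A
  subsequence of these factors converges to some factor \<open>Q'\<close> of \<open>S'\<close>, and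
  the single \<open>R\<close> with \<open>R * Q' = Qt\<close> brings its late members close to
  \<open>Qt\<close>, a contradiction.\<close>

lemma pseudo_polar_eventually_close:
  assumes pp: "\<forall>\<^sub>F n in sequentially. pseudo_polar p q (S n) (Q n) (l n)"
    and S: "mat_tendsto (p + q) S S'"
    and Qt: "pseudo_polar p q S' Qt lt" and e: "e > 0"
  shows "\<forall>\<^sub>F n in sequentially.
    \<exists>R\<in>orth_group (p + q) \<inter> indef_orth_group p q. entry_dist (p + q) (R * Q n) Qt < e"
    (is "eventually ?close _")
proof (rule ccontr)
  assume "\<not> eventually ?close sequentially"
  then have "\<exists>\<^sub>F n in sequentially. \<not> ?close n" by (simp add: frequently_def)
  then have "\<exists>\<^sub>F n in sequentially. \<not> ?close n \<and> pseudo_polar p q (S n) (Q n) (l n)"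
    by (rule frequently_rev_mp) (use pp in \<open>auto elim: eventually_mono\<close>)
  then have inf: "infinite {n. \<not> ?close n \<and> pseudo_polar p q (S n) (Q n) (l n)}"
    by (simp add: cofinite_eq_sequentially[symmetric] frequently_cofinite)
  \<comment> \<open>Bad indices are enumerated together with validity of the factorization, since
    \<open>pp\<close> holds only eventually.\<close>
  define r where "r = enumerate {n. \<not> ?close n \<and> pseudo_polar p q (S n) (Q n) (l n)}"
  have r: "strict_mono r"
    unfolding r_def by (rule strict_mono_enumerate[OF inf])
  have far: "\<not> ?close (r n)" and ppr: "pseudo_polar p q (S (r n)) (Q (r n)) (l (r n))" for n
    using enumerate_in_set[OF inf, of n] by (auto simp: r_def)
  obtain r' Q' l' where r': "strict_mono r'" and Q': "pseudo_polar p q S' Q' l'"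
    and lim: "mat_tendsto (p + q) (\<lambda>n. Q (r (r' n))) Q'"
    using pseudo_polar_convergent_subseq[OF ppr mat_tendsto_subseq[OF S r]
        pseudo_polar_carrier(1)[OF Qt] pseudo_polar_det_nonzero[OF Qt]] by blast
  obtain R where R: "R \<in> orth_group (p + q) \<inter> indef_orth_group p q" "R * Q' = Qt"
    using pseudo_polar_unique[OF Q' Qt] by blast
  have "mat_tendsto (p + q) (\<lambda>n. R * Q (r (r' n))) (R * Q')"
    using orth_indef_orth_group_carrier[OF R(1)] pseudo_polar_carrier(2)[OF Q']
      pseudo_polar_carrier(2)[OF ppr]
    by (intro mat_tendsto_mult lim) simp_all
  then have "(\<lambda>n. entry_dist (p + q) (R * Q (r (r' n))) Qt) \<longlonglongrightarrow> 0"
    using entry_dist_tendsto[of "p + q" "\<lambda>n. R * Q (r (r' n))" Qt Qt] by (simp add: R(2) entry_dist_def)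
  then have "\<forall>\<^sub>F n in sequentially. entry_dist (p + q) (R * Q (r (r' n))) Qt < e"
    using e by (rule order_tendstoD)
  then obtain n where "entry_dist (p + q) (R * Q (r (r' n))) Qt < e"
    by (auto simp: eventually_sequentially)
  then show False using far[of "r' n"] R(1) by blast
qed

section \<open>Measurable choice of near-minimizers\<close>

text \<open>Entries map matrices to functions on \<open>nat \<times> nat\<close>, whose product
  topology is second countable; hence the image of \<open>G\<close> has a countable dense subset,
  and convergence there is entrywise.\<close>

lemma mat_set_countable_dense:
  fixes G :: "real mat set"
  assumes "G \<noteq> {}"
  obtains D :: "nat \<Rightarrow> real mat" where "range D \<subseteq> G"
    "\<And>R. R \<in> G \<Longrightarrow> \<exists>k. mat_tendsto d (\<lambda>n. D (k n)) R"
proof -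
  define \<phi> :: "real mat \<Rightarrow> nat \<times> nat \<Rightarrow> real" where "\<phi> A = (\<lambda>ij. A $$ ij)" for A
  obtain T where T: "countable T" "T \<subseteq> \<phi> ` G" "\<phi> ` G \<subseteq> closure T"
    using separable by blast
  have "T \<noteq> {}" using T assms by auto
  obtain C where C: "C \<subseteq> G" "countable C" "T = \<phi> ` C"
    using T countable_subset_image[of T \<phi> G] by blast
  have "C \<noteq> {}" using \<open>T \<noteq> {}\<close> C by auto
  then have D: "range (from_nat_into C) = C"
    using C by (simp add: range_from_nat_into)
  have "\<exists>k. mat_tendsto d (\<lambda>n. from_nat_into C (k n)) R" if "R \<in> G" for R
  proof -
    have "\<phi> R \<in> closure T" using T that by auto
    then obtain x where x: "\<And>n. x n \<in> T" "x \<longlonglongrightarrow> \<phi> R"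
      unfolding closure_sequential by auto
    have "\<exists>k. x n = \<phi> (from_nat_into C k)" for n
      using x(1)[of n] D C(3) by (metis (no_types, lifting) imageE rangeE)
    then obtain k where k: "\<And>n. x n = \<phi> (from_nat_into C (k n))" by metis
    have "(\<lambda>n. x n ij) \<longlonglongrightarrow> \<phi> R ij" for ij
      using x(2) continuous_on_tendsto_compose[OF continuous_on_product_coordinates[of ij]] by auto
    then have "mat_tendsto d (\<lambda>n. from_nat_into C (k n)) R"
      unfolding mat_tendsto_def k \<phi>_def by blast
    then show ?thesis by blast
  qed
  then show ?thesis using that[of "from_nat_into C"] D C by simp
qed

lemma borel_mat_space [simp]: "space (borel_mat nr nc) = carrier_mat nr nc"
  by (simp add: borel_mat_def space_vimage_algebra)

lemma borel_mat_entry_measurable: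
  assumes "i < nr" "j < nc"
  shows "(\<lambda>A. A $$ (i, j)) \<in> borel_measurable (borel_mat nr nc)"
proof -
  have "(\<lambda>A. \<lambda>ij\<in>{..<nr} \<times> {..<nc}. A $$ ij) \<in>
      borel_mat nr nc \<rightarrow>\<^sub>M (\<Pi>\<^sub>M ij\<in>{..<nr} \<times> {..<nc}. (borel :: real measure))"
    unfolding borel_mat_def by (rule measurable_vimage_algebra1) (auto simp: space_PiM)
  from measurable_component_singleton[THEN measurable_compose_rev, OF _ this, of "(i, j)"] assms
  show ?thesis by (simp cong: measurable_cong)
qed

lemma entry_dist_mult_measurable:
  assumes R: "R \<in> carrier_mat d d"
  shows "(\<lambda>A. entry_dist d (R * A) B) \<in> borel_measurable (borel_mat d d)"
proof -
  have entry: "(R * A) $$ (i, j) = (\<Sum>h<d. R $$ (i, h) * A $$ (h, j))"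
    if "A \<in> carrier_mat d d" "i < d" "j < d" for A i j
    using that R by (simp add: scalar_prod_def atLeast0LessThan)
  have eq: "entry_dist d (R * A) B =
      (\<Sum>i<d. \<Sum>j<d. \<bar>(\<Sum>h<d. R $$ (i, h) * A $$ (h, j)) - B $$ (i, j)\<bar>)"
    if "A \<in> space (borel_mat d d)" for A
    using that unfolding entry_dist_def borel_mat_space
    by (intro sum.cong refl) (simp only: entry lessThan_iff)
  have "(\<lambda>A. \<Sum>i<d. \<Sum>j<d. \<bar>(\<Sum>h<d. R $$ (i, h) * A $$ (h, j)) - B $$ (i, j)\<bar>)
      \<in> borel_measurable (borel_mat d d)"
    by (intro borel_measurable_sum borel_measurable_abs borel_measurable_diff
        borel_measurable_times borel_measurable_const borel_mat_entry_measurable) simp_all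
  then show ?thesis
    by (simp only: measurable_cong[OF eq])
qed

text \<open>The least index within \<open>e\<close> of the infimum works: the infimum of countably
  many measurable functions is measurable, and so is a least index defined by measurable
  conditions.\<close>

lemma measurable_almost_minimizing_index:
  fixes g :: "nat \<Rightarrow> 'a \<Rightarrow> real"
  assumes g: "\<And>k. g k \<in> borel_measurable M" and nonneg: "\<And>k x. g k x \<ge> 0" and e: "e > 0"
  obtains K where "K \<in> M \<rightarrow>\<^sub>M count_space UNIV" "\<And>k x. g (K x) x < g k x + e"
proof -
  define m where "m x = (INF k. g k x)" for x
  define K where "K x = (LEAST k. g k x < m x + e)" for x
  have bdd: "bdd_below (range (\<lambda>k. g k x))" for x
    using nonneg by (intro bdd_belowI[of _ 0]) blast
  have m_le: "m x \<le> g k x" for k x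
    unfolding m_def by (rule cINF_lower[OF bdd UNIV_I])
  have "m \<in> borel_measurable M"
    unfolding m_def by (rule borel_measurable_cINF_real[OF countableI_type g])
  then have "K \<in> M \<rightarrow>\<^sub>M count_space UNIV"
    unfolding K_def
    by (intro measurable_Least borel_measurable_pred_less borel_measurable_add
        borel_measurable_const g)
  moreover have "g (K x) x < g k x + e" for k x
  proof -
    have "\<exists>k. g k x < m x + e"
      using e cINF_less_iff[OF UNIV_not_empty bdd, of x "m x + e"] by (simp add: m_def)
    then have "g (K x) x < m x + e"
      unfolding K_def by (rule LeastI_ex)
    then show ?thesis using m_le[of x k] by linarith
  qed
  ultimately show ?thesis by (rule that)
qed

text \<open>A countable dense subset of \<open>G\<close> suffices because the distance is continuous
  in \<open>R\<close>, and a choice among countably many matrices is measurable once its index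
  is.\<close>

lemma measurable_almost_minimizer:
  assumes G: "G \<subseteq> carrier_mat d d" "G \<noteq> {}" and e: "e > 0"
  shows "\<exists>f. f \<in> borel_mat d d \<rightarrow>\<^sub>M borel_mat d d \<and> (\<forall>A. f A \<in> G) \<and>
    (\<forall>A\<in>carrier_mat d d. \<forall>R\<in>G. entry_dist d (f A * A) B < entry_dist d (R * A) B + e)"
proof -
  obtain D :: "nat \<Rightarrow> real mat" where D: "range D \<subseteq> G"
    and dense: "\<And>R. R \<in> G \<Longrightarrow> \<exists>k. mat_tendsto d (\<lambda>n. D (k n)) R"
    using mat_set_countable_dense[OF G(2)] by blast
  have Dc: "D k \<in> carrier_mat d d" for k using D G by blast
  \<comment> \<open>Only \<open>e / 2\<close> is spent here: passing to limits gives a non-strict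
    inequality, and the other half restores strictness.\<close>
  obtain K where K: "K \<in> borel_mat d d \<rightarrow>\<^sub>M count_space UNIV"
    and K_min: "\<And>k A. entry_dist d (D (K A) * A) B < entry_dist d (D k * A) B + e / 2"
    using measurable_almost_minimizing_index[where g = "\<lambda>k A. entry_dist d (D k * A) B",
        OF entry_dist_mult_measurable[OF Dc] entry_dist_nonneg half_gt_zero[OF e]]
    by blast
  show ?thesis
  proof (intro exI[of _ "\<lambda>A. D (K A)"] conjI allI ballI)
    show "D (K A) \<in> G" for A using D by blast
    have "D \<in> count_space UNIV \<rightarrow>\<^sub>M borel_mat d d" using Dc by simp
    with K show "(\<lambda>A. D (K A)) \<in> borel_mat d d \<rightarrow>\<^sub>M borel_mat d d" by (rule measurable_compose)
    show "entry_dist d (D (K A) * A) B < entry_dist d (R * A) B + e"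
      if A: "A \<in> carrier_mat d d" and R: "R \<in> G" for A R
    proof -
      obtain k where k: "mat_tendsto d (\<lambda>n. D (k n)) R" using dense[OF R] by blast
      have "mat_tendsto d (\<lambda>n. D (k n) * A) (R * A)"
        using A R G Dc by (intro mat_tendsto_mult[OF k]) auto
      then have "(\<lambda>n. entry_dist d (D (k n) * A) B) \<longlonglongrightarrow> entry_dist d (R * A) B"
        by (rule entry_dist_tendsto)
      then have "(\<lambda>n. entry_dist d (D (k n) * A) B + e / 2) \<longlonglongrightarrow> entry_dist d (R * A) B + e / 2"
        by (intro tendsto_add tendsto_const)
      then have "entry_dist d (D (K A) * A) B \<le> entry_dist d (R * A) B + e / 2"
        by (rule LIMSEQ_le_const) (use K_min less_imp_le in blast)
      then show ?thesis using e by simp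
    qed
  qed
qed

section \<open>Comparison with the spectral norm\<close>

text \<open>On the unit ball every coordinate is at most 1 in absolute value, and the Euclidean norm
  of the image is at most the sum of its absolute entries.\<close>

lemma spectral_norm_le_entries:
  assumes A: "A \<in> carrier_mat d d"
  shows "0 \<le> spectral_norm A" "spectral_norm A \<le> (\<Sum>i<d. \<Sum>j<d. \<bar>A $$ (i, j)\<bar>)"
proof -
  let ?K = "\<Sum>i<d. \<Sum>j<d. \<bar>A $$ (i, j)\<bar>"
  let ?V = "{v \<in> carrier_vec (dim_col A). sqrt (scalar_prod v v) \<le> 1}"
  have bound: "sqrt (scalar_prod (A *\<^sub>v v) (A *\<^sub>v v)) \<le> ?K" if v: "v \<in> ?V" for v
  proof -
    have vd: "v \<in> carrier_vec d" using v A by auto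
    have sq: "scalar_prod w w = (\<Sum>i<d. (w $ i)\<^sup>2)" if "w \<in> carrier_vec d" for w :: "real vec"
      using that by (simp add: scalar_prod_def atLeast0LessThan power2_eq_square)
    have le1: "\<bar>v $ j\<bar> \<le> 1" if "j < d" for j
    proof -
      have "(v $ j)\<^sup>2 \<le> scalar_prod v v"
        unfolding sq[OF vd] using that by (intro member_le_sum) auto
      also have "\<dots> \<le> 1" using v by simp
      finally show ?thesis by (simp add: abs_square_le_1)
    qed
    have Av: "A *\<^sub>v v \<in> carrier_vec d" using A vd by auto
    have "sqrt (scalar_prod (A *\<^sub>v v) (A *\<^sub>v v)) = L2_set (\<lambda>i. (A *\<^sub>v v) $ i) {..<d}"
      unfolding sq[OF Av] L2_set_def ..
    also have "\<dots> \<le> (\<Sum>i<d. \<bar>(A *\<^sub>v v) $ i\<bar>)" by (rule L2_set_le_sum_abs)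
    also have "\<dots> \<le> ?K"
    proof (rule sum_mono)
      fix i assume i: "i \<in> {..<d}"
      have "\<bar>(A *\<^sub>v v) $ i\<bar> = \<bar>\<Sum>j<d. A $$ (i, j) * v $ j\<bar>"
        using i A vd by (simp add: scalar_prod_def atLeast0LessThan)
      also have "\<dots> \<le> (\<Sum>j<d. \<bar>A $$ (i, j)\<bar> * \<bar>v $ j\<bar>)"
        by (rule order_trans[OF sum_abs]) (simp add: abs_mult)
      also have "\<dots> \<le> (\<Sum>j<d. \<bar>A $$ (i, j)\<bar>)"
        using le1 by (intro sum_mono) (auto intro: mult_left_le)
      finally show "\<bar>(A *\<^sub>v v) $ i\<bar> \<le> (\<Sum>j<d. \<bar>A $$ (i, j)\<bar>)" .
    qed
    finally show ?thesis .
  qed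
  \<comment> \<open>The zero vector makes the supremum range over a nonempty set, and its image
    gives the lower bound 0.\<close>
  have zero: "0\<^sub>v (dim_col A) \<in> ?V" by simp
  show "spectral_norm A \<le> ?K"
    unfolding spectral_norm_def using zero bound by (intro cSUP_least) blast+
  have "0 = sqrt (scalar_prod (A *\<^sub>v 0\<^sub>v (dim_col A)) (A *\<^sub>v 0\<^sub>v (dim_col A)))"
    using A by (simp add: scalar_prod_def)
  also have "\<dots> \<le> spectral_norm A"
    unfolding spectral_norm_def using zero bound by (intro cSUP_upper) (auto intro!: bdd_aboveI2)
  finally show "0 \<le> spectral_norm A" .
qed

section \<open>Sample second moments\<close>

text \<open>Hoeffding's inequality bounds the probability of a deviation by \<open>e\<close>
  geometrically in \<open>n\<close>, so Borel-Cantelli excludes infinitely many deviations; letting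
  \<open>e\<close> run through the countably many \<open>1 / (m + 1)\<close> gives
  convergence.\<close>

lemma bounded_strong_law:
  fixes M :: "'a measure" and Y :: "nat \<Rightarrow> 'a \<Rightarrow> real"
  assumes M: "prob_space M"
    and indep: "prob_space.indep_vars M (\<lambda>_. borel) Y UNIV"
    and bound: "\<And>i. AE x in M. \<bar>Y i x\<bar> \<le> c"
    and mean: "\<And>i. (\<integral>x. Y i x \<partial>M) = \<mu>"
  shows "AE x in M. (\<lambda>n. (\<Sum>i<n. Y i x) / n) \<longlonglongrightarrow> \<mu>"
proof -
  interpret prob_space M by (rule M)
  \<comment> \<open>Adding 1 keeps \<open>C\<close> positive even when \<open>c = 0\<close>, as the
    exponent \<open>\<kappa>\<close> below divides by \<open>C\<close>.\<close>
  define C where "C = \<bar>c\<bar> + 1"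
  have C: "C > 0" by (simp add: C_def)
  have Y_meas: "random_variable borel (Y i)" for i
    using indep by (auto simp: indep_vars_def)
  have ev: "AE x in M. \<forall>\<^sub>F n in sequentially. \<bar>(\<Sum>i<n. Y i x) - n * \<mu>\<bar> < n * e" if e: "e > 0" for e :: real
  proof -
    define A where "A n = {x \<in> space M. \<bar>(\<Sum>i<n. Y i x) - n * \<mu>\<bar> \<ge> real n * e}" for n :: nat
    \<comment> \<open>The Hoeffding exponent
      \<open>2 * (n * e)\<^sup>2 / (n * (2 * C)\<^sup>2)\<close> equals
      \<open>n * \<kappa>\<close>.\<close>
    define \<kappa> where "\<kappa> = e\<^sup>2 / (2 * C\<^sup>2)"
    have \<kappa>: "\<kappa> > 0" using e C by (simp add: \<kappa>_def)
    have A_events: "A n \<in> events" for n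
      unfolding A_def
      by (intro borel_measurable_le borel_measurable_const borel_measurable_abs
          borel_measurable_diff borel_measurable_sum Y_meas)
    have prob_A: "prob (A n) \<le> 2 * exp (- \<kappa>) ^ n" for n
    proof (cases "n = 0")
      case True
      then show ?thesis by (simp add: order_trans[OF prob_le_1])
    next
      case False
      interpret H: Hoeffding_ineq M "{..<n}" Y "\<lambda>_. - C" "\<lambda>_. C" "n * \<mu>"
      proof unfold_locales
        show "indep_vars (\<lambda>_. borel) Y {..<n}"
          using indep by (rule indep_vars_subset) simp
        show "AE x in M. Y i x \<in> {- C..C}" for i
          using bound[of i] by eventually_elim (auto simp: C_def)
        show "n * \<mu> \<equiv> \<Sum>i<n. expectation (Y i)"
          by (rule eq_reflection) (simp add: mean)
      qed simp
      have "prob (A n) \<le> 2 * exp (- 2 * (real n * e)\<^sup>2 / (\<Sum>i<n. (C - - C)\<^sup>2))"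
        unfolding A_def using e C False by (intro H.Hoeffding_ineq_abs_ge) auto
      also have "- 2 * (real n * e)\<^sup>2 / (\<Sum>i<n. (C - - C)\<^sup>2) = n * (- \<kappa>)"
        using False C by (simp add: \<kappa>_def power2_eq_square field_simps)
      finally show ?thesis by (simp only: exp_of_nat_mult)
    qed
    have "summable (\<lambda>n. 2 * exp (- \<kappa>) ^ n)"
      using \<kappa> by (intro summable_mult summable_geometric) auto
    then have "summable (\<lambda>n. prob (A n))"
      by (rule summable_comparison_test_ev[rotated]) (use prob_A in auto)
    then have "AE x in M. \<forall>\<^sub>F n in sequentially. x \<in> space M - A n"
      by (intro borel_cantelli_AE1) (auto simp: emeasure_eq_measure A_events)
    then show ?thesis
      by eventually_elim (auto elim!: eventually_mono simp: A_def not_le)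
  qed
  have "AE x in M. \<forall>m. \<forall>\<^sub>F n in sequentially. \<bar>(\<Sum>i<n. Y i x) - n * \<mu>\<bar> < n * inverse (real (Suc m))"
    unfolding AE_all_countable by (intro allI ev) simp
  then show ?thesis
  proof eventually_elim
    fix x assume *: "\<forall>m. \<forall>\<^sub>F n in sequentially. \<bar>(\<Sum>i<n. Y i x) - n * \<mu>\<bar> < n * inverse (real (Suc m))"
    show "(\<lambda>n. (\<Sum>i<n. Y i x) / n) \<longlonglongrightarrow> \<mu>"
    proof (rule tendstoI)
      fix e :: real assume "e > 0"
      then obtain m where m: "inverse (real (Suc m)) < e" using reals_Archimedean by blast
      have "\<forall>\<^sub>F n in sequentially. \<bar>(\<Sum>i<n. Y i x) - n * \<mu>\<bar> < n * inverse (real (Suc m))"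
        using * by blast
      then show "\<forall>\<^sub>F n in sequentially. dist ((\<Sum>i<n. Y i x) / n) \<mu> < e"
        using eventually_gt_at_top[of 0]
      proof eventually_elim
        fix n :: nat
        assume le: "\<bar>(\<Sum>i<n. Y i x) - n * \<mu>\<bar> < n * inverse (real (Suc m))" and n: "n > 0"
        have "dist ((\<Sum>i<n. Y i x) / n) \<mu> = \<bar>(\<Sum>i<n. Y i x) - n * \<mu>\<bar> / n"
        proof -
          have "(\<Sum>i<n. Y i x) / n - \<mu> = ((\<Sum>i<n. Y i x) - n * \<mu>) / n"
            using n by (simp add: field_simps)
          then show ?thesis by (simp add: dist_real_def abs_divide)
        qed
        also have "\<dots> < inverse (real (Suc m))"
          using le n by (simp add: divide_less_eq mult.commute)
        finally show "dist ((\<Sum>i<n. Y i x) / n) \<mu> < e" using m by simp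
      qed
    qed
  qed
qed

section \<open>Boundedness of the support\<close>

lemma space_borel_vec [simp]: "space (borel_vec d) = carrier_vec d"
  by (simp add: borel_vec_def space_vimage_algebra)

lemma borel_vec_entry_measurable:
  assumes "i < d"
  shows "(\<lambda>v. v $ i) \<in> borel_measurable (borel_vec d)"
proof -
  have "(\<lambda>v. \<lambda>i\<in>{..<d}. v $ i) \<in> borel_vec d \<rightarrow>\<^sub>M (\<Pi>\<^sub>M i\<in>{..<d}. (borel :: real measure))"
    unfolding borel_vec_def by (rule measurable_vimage_algebra1) (auto simp: space_PiM)
  from measurable_component_singleton[THEN measurable_compose_rev, OF _ this, of i] assms
  show ?thesis by (simp cong: measurable_cong)
qed

lemma mult_mat_vec_entry:
  fixes A :: "real mat"
  assumes "A \<in> carrier_mat d d" "v \<in> carrier_vec d" "i < d"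
  shows "(A *\<^sub>v v) $ i = (\<Sum>j<d. A $$ (i, j) * v $ j)"
  using assms by (simp add: scalar_prod_def atLeast0LessThan)

text \<open>For \<open>x\<close> in the support, \<open>(\<Delta> I x)\<^sub>k\<close> is the mean of \<open>(x\<^sup>T I y) y\<^sub>k\<close> over \<open>y\<close>, hence at most
  \<open>E \<bar>y\<^sub>k\<bar>\<close> in absolute value; invertibility of \<open>\<Delta> I\<close> turns this into a bound on \<open>x\<close>.\<close>

lemma gen_inner_product_distr_bounded:
  assumes F: "gen_inner_product_distr p q F"
    and moments: "finite_second_moments (p + q) F"
    and det: "det (second_moment_mat (p + q) F * sig_mat p q) \<noteq> 0"
  obtains C where "AE x in F. \<forall>j<p + q. \<bar>x $ j\<bar> \<le> C"
proof -
  let ?d = "p + q" and ?s = "sig_sgn p"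
  obtain \<Omega> where \<Omega>: "\<Omega> \<subseteq> carrier_vec ?d" "AE x in F. x \<in> \<Omega>"
    and ip: "\<And>x y. x \<in> \<Omega> \<Longrightarrow> y \<in> \<Omega> \<Longrightarrow> scalar_prod x (sig_mat p q *\<^sub>v y) \<in> {0..1}"
    using F unfolding gen_inner_product_distr_def by blast
  interpret prob_space F using F by (simp add: gen_inner_product_distr_def)
  have sets_F: "sets F = sets (borel_vec ?d)"
    using F by (simp add: gen_inner_product_distr_def)
  have entry_meas: "(\<lambda>v. v $ i) \<in> borel_measurable F" if "i < ?d" for i
    using borel_vec_entry_measurable[OF that] by (simp only: measurable_cong_sets[OF sets_F refl])
  have integ: "integrable F (\<lambda>y. y $ i * y $ j)" if "i < ?d" "j < ?d" for i j
    using moments that by (simp add: finite_second_moments_def)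
  \<comment> \<open>Second moments control first moments, which the constants \<open>K k\<close>
    below require.\<close>
  have integ1: "integrable F (\<lambda>y. y $ i)" if i: "i < ?d" for i
  proof (rule Bochner_Integration.integrable_bound)
    show "integrable F (\<lambda>y. 1 + y $ i * y $ i)" using integ i by simp
    have "\<bar>t\<bar> \<le> 1 + t * t" for t :: real
      using zero_le_power2[of "\<bar>t\<bar> - 1"] by (simp add: power2_eq_square algebra_simps)
    then show "AE y in F. norm (y $ i) \<le> norm (1 + y $ i * y $ i)"
      by (simp add: abs_of_nonneg)
  qed (rule entry_meas[OF i])
  let ?N = "second_moment_mat ?d F * sig_mat p q"
  have N: "?N \<in> carrier_mat ?d ?d" by (simp add: second_moment_mat_def mult_carrier_mat[of _ ?d ?d])
  have N_entry: "?N $$ (k, i) = (\<integral>y. y $ i * y $ k \<partial>F) * ?s i" if "k < ?d" "i < ?d" for k i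
    using that unfolding sig_mat_eq_mat_diag
    by (simp add: second_moment_mat_def mat_diag_mult_right[of _ ?d ?d] mult.commute[of "_ $ k"])
  define K where "K k = (\<integral>y. \<bar>y $ k\<bar> \<partial>F)" for k
  have Nx: "\<bar>(?N *\<^sub>v x) $ k\<bar> \<le> K k" if x: "x \<in> \<Omega>" and k: "k < ?d" for x k
  proof -
    have xc: "x \<in> carrier_vec ?d" using x \<Omega> by blast
    have ip': "\<bar>\<Sum>i<?d. x $ i * ?s i * y $ i\<bar> \<le> 1" if y: "y \<in> \<Omega>" for y
    proof -
      have yc: "y \<in> carrier_vec ?d" using y \<Omega> by blast
      have "(sig_mat p q *\<^sub>v y) $ i = ?s i * y $ i" if "i < ?d" for i
      proof -
        have "(sig_mat p q *\<^sub>v y) $ i = (\<Sum>j<?d. (if i = j then ?s j else 0) * y $ j)"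
          using that yc unfolding sig_mat_eq_mat_diag
          by (simp add: mat_diag_def scalar_prod_def atLeast0LessThan)
        also have "\<dots> = (\<Sum>j<?d. if j = i then ?s j * y $ j else 0)"
          by (intro sum.cong) auto
        finally show ?thesis using that by simp
      qed
      moreover have "dim_vec (sig_mat p q *\<^sub>v y) = ?d"
        using carrier_matD[OF sig_mat_carrier[of p q]] by simp
      ultimately have "scalar_prod x (sig_mat p q *\<^sub>v y) = (\<Sum>i<?d. x $ i * ?s i * y $ i)"
        by (simp add: scalar_prod_def atLeast0LessThan mult.assoc)
      then show ?thesis using ip[OF x y] by simp
    qed
    have "(?N *\<^sub>v x) $ k = (\<Sum>i<?d. ?N $$ (k, i) * x $ i)"
      using N xc k by (rule mult_mat_vec_entry)
    also have "\<dots> = (\<Sum>i<?d. \<integral>y. x $ i * ?s i * (y $ i * y $ k) \<partial>F)"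
    proof (intro sum.cong refl)
      fix i assume "i \<in> {..<?d}"
      then have "?N $$ (k, i) * x $ i = x $ i * ?s i * (\<integral>y. y $ i * y $ k \<partial>F)"
        using N_entry[OF k, of i] by simp
      then show "?N $$ (k, i) * x $ i = (\<integral>y. x $ i * ?s i * (y $ i * y $ k) \<partial>F)"
        by simp
    qed
    also have "\<dots> = (\<integral>y. (\<Sum>i<?d. x $ i * ?s i * (y $ i * y $ k)) \<partial>F)"
      using integ k by (subst Bochner_Integration.integral_sum) auto
    also have "\<bar>\<dots>\<bar> \<le> (\<integral>y. \<bar>\<Sum>i<?d. x $ i * ?s i * (y $ i * y $ k)\<bar> \<partial>F)"
      by (rule integral_abs_bound)
    also have "\<dots> \<le> K k"
      unfolding K_def
    proof (rule integral_mono_AE)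
      show "integrable F (\<lambda>y. \<bar>\<Sum>i<?d. x $ i * ?s i * (y $ i * y $ k)\<bar>)"
        using integ k by (intro integrable_abs Bochner_Integration.integrable_sum integrable_mult_right) auto
      show "integrable F (\<lambda>y. \<bar>y $ k\<bar>)" using integ1 k by simp
      show "AE y in F. \<bar>\<Sum>i<?d. x $ i * ?s i * (y $ i * y $ k)\<bar> \<le> \<bar>y $ k\<bar>"
        using \<Omega>(2)
      proof eventually_elim
        fix y assume "y \<in> \<Omega>"
        then have "\<bar>\<Sum>i<?d. x $ i * ?s i * y $ i\<bar> * \<bar>y $ k\<bar> \<le> 1 * \<bar>y $ k\<bar>"
          by (intro mult_right_mono ip') simp_all
        then show "\<bar>\<Sum>i<?d. x $ i * ?s i * (y $ i * y $ k)\<bar> \<le> \<bar>y $ k\<bar>"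
          by (simp add: sum_distrib_right mult.assoc flip: abs_mult)
      qed
    qed
    finally show ?thesis .
  qed
  note inv = inv_mat[OF N det]
  let ?B = "inv_mat ?N"
  define C where "C = (\<Sum>j<?d. \<Sum>k<?d. \<bar>?B $$ (j, k)\<bar> * K k)"
  have "\<bar>x $ j\<bar> \<le> C" if x: "x \<in> \<Omega>" and j: "j < ?d" for x j
  proof -
    have xc: "x \<in> carrier_vec ?d" using x \<Omega> by blast
    have Nxc: "?N *\<^sub>v x \<in> carrier_vec ?d" using N xc by auto
    have "?B *\<^sub>v (?N *\<^sub>v x) = x"
      using assoc_mult_mat_vec[OF inv(1) N xc] inv(3) xc by simp
    then have "x $ j = (\<Sum>k<?d. ?B $$ (j, k) * (?N *\<^sub>v x) $ k)"
      using mult_mat_vec_entry[OF inv(1) Nxc j] by simp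
    then have "\<bar>x $ j\<bar> \<le> (\<Sum>k<?d. \<bar>?B $$ (j, k) * (?N *\<^sub>v x) $ k\<bar>)"
      by (simp only: sum_abs)
    also have "\<dots> \<le> (\<Sum>k<?d. \<bar>?B $$ (j, k)\<bar> * K k)"
    proof (rule sum_mono)
      fix k assume "k \<in> {..<?d}"
      then have "\<bar>(?N *\<^sub>v x) $ k\<bar> \<le> K k" using Nx[OF x] by blast
      then show "\<bar>?B $$ (j, k) * (?N *\<^sub>v x) $ k\<bar> \<le> \<bar>?B $$ (j, k)\<bar> * K k"
        unfolding abs_mult by (rule mult_left_mono) (rule abs_ge_zero)
    qed
    also have "\<dots> \<le> C"
      unfolding C_def using j
      by (intro member_le_sum[of j _ "\<lambda>j. \<Sum>k<?d. \<bar>?B $$ (j, k)\<bar> * K k"])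
        (simp_all add: K_def sum_nonneg)
    finally show ?thesis .
  qed
  then have "AE x in F. \<forall>j<?d. \<bar>x $ j\<bar> \<le> C"
    using \<Omega>(2) by (auto elim: eventually_mono)
  then show ?thesis by (rule that)
qed

text \<open>A kernel vector of \<open>A\<close> is one of the Gram matrix. Linear dependence
  concerns the set of columns, so repeated columns are excluded beforehand: they would give the Gram
  matrix two equal columns.\<close>

lemma gram_det_nonzero_full_rank:
  fixes A :: "real mat"
  assumes A: "A \<in> carrier_mat n d" and det: "det (A\<^sup>T * A) \<noteq> 0"
  shows "vec_space.rank n A = d"
proof -
  have G: "A\<^sup>T * A \<in> carrier_mat d d" using A by (simp add: mult_carrier_mat[of _ d n])
  have dist: "distinct (cols A)"
  proof (rule ccontr)
    assume "\<not> distinct (cols A)"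
    then obtain i j where ij: "i < d" "j < d" "i \<noteq> j" "col A i = col A j"
      using A by (auto simp: distinct_conv_nth)
    have "col (A\<^sup>T * A) i = col (A\<^sup>T * A) j"
      using ij A by (simp add: col_mult2[of _ d n _ d])
    then show False using det_identical_cols[OF G ij(3,1,2)] det by blast
  qed
  have "\<not> module.lin_dep class_ring (module_vec TYPE(real) n) (set (cols A))"
  proof
    assume "module.lin_dep class_ring (module_vec TYPE(real) n) (set (cols A))"
    then obtain v where v: "v \<in> carrier_vec d" "v \<noteq> 0\<^sub>v d" "A *\<^sub>v v = 0\<^sub>v n"
      using vec_space.lin_depE[OF A _ dist] by blast
    have "(A\<^sup>T * A) *\<^sub>v v = A\<^sup>T *\<^sub>v (A *\<^sub>v v)"
      using A v by (intro assoc_mult_mat_vec) auto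
    also have "\<dots> = 0\<^sub>v d" unfolding v(3) using A by (intro eq_vecI) (auto simp: scalar_prod_def)
    finally show False using det v det_0_iff_vec_prod_zero[OF G] by blast
  qed
  then show ?thesis using vec_space.lin_indpt_full_rank[OF A dist] by simp
qed

lemma pseudo_polar_smult:
  assumes "pseudo_polar p q S Q l" "c > 0"
  shows "pseudo_polar p q (c \<cdot>\<^sub>m S) Q (\<lambda>i. c * l i)"
proof -
  let ?d = "p + q"
  have Q: "Q \<in> carrier_mat ?d ?d" by (rule pseudo_polar_carrier[OF assms(1)])
  have "mat_diag ?d (\<lambda>i. c * l i) = c \<cdot>\<^sub>m mat_diag ?d l"
    by (rule eq_matI) (auto simp: mat_diag_def)
  then have "Q\<^sup>T * mat_diag ?d (\<lambda>i. c * l i) * Q = c \<cdot>\<^sub>m (Q\<^sup>T * mat_diag ?d l * Q)"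
    using Q by (simp add: mult_smult_distrib[of _ ?d ?d _ ?d] mult_smult_assoc_mat[of _ ?d ?d _ ?d]
        mult_carrier_mat[of _ ?d ?d _ ?d])
  then show ?thesis using assms by (simp add: pseudo_polar_def)
qed

lemma data_mat_carrier [simp]: "data_mat d x n \<in> carrier_mat n d"
  by (simp add: data_mat_def mat_of_rows_def)

lemma data_mat_gram_entry:
  assumes "j < d" "k < d"
  shows "((data_mat d x n)\<^sup>T * data_mat d x n) $$ (j, k) = (\<Sum>i<n. x i $ j * x i $ k)"
  using assms by (simp add: data_mat_def mat_of_rows_def scalar_prod_def atLeast0LessThan)

section \<open>Almost sure alignment of the sample factors\<close>

theorem corollary1:
  fixes p q d :: nat
    and F :: "real vec measure"
    and M :: "'w measure"
    and X :: "nat \<Rightarrow> 'w \<Rightarrow> real vec"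
    and XX P U L Q :: "nat \<Rightarrow> 'w \<Rightarrow> real mat"
  defines "d \<equiv> p + q"
    and "XX \<equiv> \<lambda>n \<omega>. data_mat d (\<lambda>i. X i \<omega>) n"
    and "P \<equiv> \<lambda>n \<omega>. XX n \<omega> * sig_mat p q * (XX n \<omega>)\<^sup>T"
  assumes F: "gen_inner_product_distr p q F"
    and M: "prob_space M"
    and X_indep: "prob_space.indep_vars M (\<lambda>_. borel_vec d) X UNIV"
    and X_distr: "\<And>i. distr M (borel_vec d) (X i) = F"
    and moments: "finite_second_moments d F"
    and full_rank: "vec_space.rank d (second_moment_mat d F * sig_mat p q) = d"
    and UL: "\<And>n \<omega>. \<omega> \<in> space M \<Longrightarrow> vec_space.rank n (XX n \<omega>) = d \<Longrightarrow>
               nonzero_eigendecomp n d (P n \<omega>) (U n \<omega>) (L n \<omega>)"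
    and Q: "\<And>n \<omega>. \<omega> \<in> space M \<Longrightarrow> vec_space.rank n (XX n \<omega>) = d \<Longrightarrow>
               Q n \<omega> \<in> carrier_mat d d \<and> U n \<omega> * sqrt_abs_mat (L n \<omega>) * Q n \<omega> = XX n \<omega>"
  shows "\<exists>(W :: nat \<Rightarrow> 'w \<Rightarrow> real mat) Qt.
           Qt \<in> carrier_mat d d \<and>
           (\<forall>n. \<forall>\<omega>\<in>space M. W n \<omega> \<in> orth_group d \<inter> indef_orth_group p q) \<and>
           (\<forall>n. Q n \<in> M \<rightarrow>\<^sub>M borel_mat d d \<longrightarrow> W n \<in> M \<rightarrow>\<^sub>M borel_mat d d) \<and>
           (AE \<omega> in M. (\<lambda>n. spectral_norm (W n \<omega> * Q n \<omega> - Qt)) \<longlonglongrightarrow> 0)"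
proof -
  interpret prob_space M by (rule M)
  define G where "G = orth_group d \<inter> indef_orth_group p q"
  define \<Delta> where "\<Delta> = second_moment_mat d F"
  \<comment> \<open>At \<open>n = 0\<close> the factor \<open>1 / real n\<close> is 0 and
    \<open>S\<close> is a zero matrix; only large \<open>n\<close> matter for the limit.\<close>
  define S where "S n \<omega> = (1 / real n) \<cdot>\<^sub>m ((XX n \<omega>)\<^sup>T * XX n \<omega>)" for n \<omega>
  have XX [simp]: "XX n \<omega> \<in> carrier_mat n d" for n \<omega> by (simp add: XX_def)
  have S_carrier [simp]: "S n \<omega> \<in> carrier_mat d d" for n \<omega>
    by (simp add: S_def mult_carrier_mat[of _ d n])
  have \<Delta> [simp]: "\<Delta> \<in> carrier_mat d d" by (simp add: \<Delta>_def second_moment_mat_def)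
  have sig [simp]: "sig_mat p q \<in> carrier_mat d d" by (simp add: d_def)
  have det_\<Delta>I: "det (\<Delta> * sig_mat p q) \<noteq> 0"
    using vec_space.det_rank_iff[of "\<Delta> * sig_mat p q" d] full_rank
    by (simp add: \<Delta>_def mult_carrier_mat[of _ d d] second_moment_mat_def)
  then have det_\<Delta>: "det \<Delta> \<noteq> 0" by (auto simp: det_mult[of _ d])

  have X_meas: "X i \<in> M \<rightarrow>\<^sub>M borel_vec d" for i
    using X_indep by (auto simp: indep_vars_def)
  obtain C where C: "AE x in F. \<forall>j<d. \<bar>x $ j\<bar> \<le> C"
    using gen_inner_product_distr_bounded[OF F moments[unfolded d_def]] det_\<Delta>I
    by (auto simp: \<Delta>_def d_def)
  \<comment> \<open>Products of two coordinates are almost surely bounded by \<open>C * C\<close>,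
    so their averages fall under the bounded strong law.\<close>
  have "AE \<omega> in M. (\<lambda>n. S n \<omega> $$ (j, k)) \<longlonglongrightarrow> \<Delta> $$ (j, k)" if jk: "j < d" "k < d" for j k
  proof -
    define h where "h = (\<lambda>x :: real vec. x $ j * x $ k)"
    have h: "h \<in> borel_measurable (borel_vec d)"
      unfolding h_def by (intro borel_measurable_times borel_vec_entry_measurable jk)
    have "AE \<omega> in M. (\<lambda>n. (\<Sum>i<n. h (X i \<omega>)) / n) \<longlonglongrightarrow> (\<integral>x. h x \<partial>F)"
    proof (rule bounded_strong_law[OF M])
      show "indep_vars (\<lambda>_. borel) (\<lambda>i \<omega>. h (X i \<omega>)) UNIV"
        using X_indep h by (rule indep_vars_compose2)
      show "expectation (\<lambda>\<omega>. h (X i \<omega>)) = (\<integral>x. h x \<partial>F)" for i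
        using integral_distr[OF X_meas[of i] h] by (simp add: X_distr)
      show "AE \<omega> in M. \<bar>h (X i \<omega>)\<bar> \<le> C * C" for i
      proof -
        have "AE x in distr M (borel_vec d) (X i). \<forall>j<d. \<bar>x $ j\<bar> \<le> C"
          unfolding X_distr by (rule C)
        then have "AE \<omega> in M. \<forall>j<d. \<bar>X i \<omega> $ j\<bar> \<le> C"
          by (rule AE_distrD[OF X_meas])
        then show ?thesis
        proof eventually_elim
          fix \<omega> assume *: "\<forall>j<d. \<bar>X i \<omega> $ j\<bar> \<le> C"
          then have "0 \<le> C" using jk(1) by fastforce
          then show "\<bar>h (X i \<omega>)\<bar> \<le> C * C"
            unfolding h_def abs_mult using * jk by (intro mult_mono) auto
        qed
      qed
    qed
    then show ?thesis
    proof eventually_elim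
      fix \<omega> assume "(\<lambda>n. (\<Sum>i<n. h (X i \<omega>)) / n) \<longlonglongrightarrow> (\<integral>x. h x \<partial>F)"
      moreover have "S n \<omega> $$ (j, k) = (\<Sum>i<n. h (X i \<omega>)) / n" for n
        using jk carrier_matD[OF XX[of n \<omega>]] data_mat_gram_entry[OF jk, of "\<lambda>i. X i \<omega>" n]
        by (simp add: S_def h_def XX_def)
      moreover have "\<Delta> $$ (j, k) = (\<integral>x. h x \<partial>F)"
        using jk by (simp add: \<Delta>_def second_moment_mat_def h_def)
      ultimately show "(\<lambda>n. S n \<omega> $$ (j, k)) \<longlonglongrightarrow> \<Delta> $$ (j, k)" by simp
    qed
  qed
  then have "AE \<omega> in M. \<forall>j\<in>{..<d}. \<forall>k\<in>{..<d}. (\<lambda>n. S n \<omega> $$ (j, k)) \<longlonglongrightarrow> \<Delta> $$ (j, k)"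
    by (intro AE_finite_allI) auto
  then have S_lim: "AE \<omega> in M. mat_tendsto d (\<lambda>n. S n \<omega>) \<Delta>"
    by (rule AE_mp) (auto simp: mat_tendsto_def)

  define l where "l n \<omega> i = 1 / real n * \<bar>L n \<omega> $$ (i, i)\<bar>" for n \<omega> i
  have pp: "\<forall>\<^sub>F n in sequentially. pseudo_polar p q (S n \<omega>) (Q n \<omega>) (l n \<omega>)"
    if \<omega>: "\<omega> \<in> space M" and lim: "mat_tendsto d (\<lambda>n. S n \<omega>) \<Delta>" for \<omega>
  proof -
    \<comment> \<open>The assumptions on \<open>U\<close>, \<open>L\<close> and \<open>Q\<close>
      speak only of data matrices of rank \<open>d\<close>; convergence to an invertible limit
      ensures that rank for all large \<open>n\<close>.\<close>
    have "(\<lambda>n. det (S n \<omega>)) \<longlonglongrightarrow> det \<Delta>" by (rule tendsto_det[OF lim]) simp_all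
    then have "\<forall>\<^sub>F n in sequentially. det (S n \<omega>) \<noteq> 0"
      using det_\<Delta> by (rule tendsto_imp_eventually_ne)
    then show ?thesis
      using eventually_gt_at_top[of 0]
    proof eventually_elim
      fix n :: nat assume det: "det (S n \<omega>) \<noteq> 0" and n: "n > 0"
      have "det ((XX n \<omega>)\<^sup>T * XX n \<omega>) \<noteq> 0"
        using det unfolding S_def by auto
      then have rank: "vec_space.rank n (XX n \<omega>) = d"
        by (rule gram_det_nonzero_full_rank[OF XX])
      show "pseudo_polar p q (S n \<omega>) (Q n \<omega>) (l n \<omega>)"
        unfolding S_def l_def
        using UL[OF \<omega> rank] Q[OF \<omega> rank] XX[of n \<omega>] n
        by (intro pseudo_polar_smult eigendecomp_pseudo_polar[of _ n _ _ "U n \<omega>"])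
          (simp_all add: P_def d_def)
    qed
  qed

  \<comment> \<open>\<open>Qt\<close> must not depend on the outcome. Since \<open>\<Delta>\<close>
    is deterministic, any factor of it serves, and one outcome in the almost sure event supplies
    one.\<close>
  obtain Qt lt where Qt: "pseudo_polar p q \<Delta> Qt lt"
  proof -
    have "AE \<omega> in M. \<omega> \<in> space M \<and> mat_tendsto d (\<lambda>n. S n \<omega>) \<Delta>"
      using S_lim by simp
    then obtain \<omega> where \<omega>: "\<omega> \<in> space M" "mat_tendsto d (\<lambda>n. S n \<omega>) \<Delta>"
      using eventually_happens' [OF ae_filter_bot] by blast
    obtain N where "\<forall>n\<ge>N. pseudo_polar p q (S n \<omega>) (Q n \<omega>) (l n \<omega>)"
      using pp[OF \<omega>] by (auto simp: eventually_sequentially)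
    \<comment> \<open>Shifting by \<open>N\<close> makes the factorization hold at every index, as
      the compactness lemma demands.\<close>
    then have N: "pseudo_polar p q (S (n + N) \<omega>) (Q (n + N) \<omega>) (l (n + N) \<omega>)" for n
      by simp
    have "mat_tendsto d (\<lambda>n. S (n + N) \<omega>) \<Delta>"
      using \<omega>(2) by (rule mat_tendsto_subseq) (simp add: strict_mono_def)
    then show ?thesis
      using pseudo_polar_convergent_subseq[where S = "\<lambda>n. S (n + N) \<omega>" and Q = "\<lambda>n. Q (n + N) \<omega>"
          and l = "\<lambda>n. l (n + N) \<omega>" and S' = \<Delta>, OF N] \<Delta> det_\<Delta> that unfolding d_def by blast
  qed
  have Qt_carrier: "Qt \<in> carrier_mat d d"
    using pseudo_polar_carrier(2)[OF Qt] by (simp add: d_def)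

  have G: "G \<subseteq> carrier_mat d d" by (auto simp: G_def orth_group_def)
  have "1\<^sub>m d \<in> G" by (simp add: G_def orth_group_def indef_orth_group_def d_def[symmetric]
      left_mult_one_mat[OF sig] right_mult_one_mat[OF sig])
  then have "G \<noteq> {}" by blast
  \<comment> \<open>The tolerance \<open>1 / (n + 1)\<close> tends to 0. Each \<open>f n\<close> is
    a fixed map with values in \<open>G\<close> everywhere, so \<open>W n\<close> stays in the group
    even where the rank is deficient, and it inherits measurability from \<open>Q n\<close>.\<close>
  then have "\<forall>n. \<exists>f. f \<in> borel_mat d d \<rightarrow>\<^sub>M borel_mat d d \<and> (\<forall>A. f A \<in> G) \<and>
      (\<forall>A\<in>carrier_mat d d. \<forall>R\<in>G.
        entry_dist d (f A * A) Qt < entry_dist d (R * A) Qt + inverse (real (Suc n)))"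
    by (intro allI measurable_almost_minimizer[OF G]) simp_all
  from choice[OF this] obtain f where f: "\<And>n A. f n A \<in> G"
      "\<And>n. f n \<in> borel_mat d d \<rightarrow>\<^sub>M borel_mat d d"
    and f_min: "\<And>n A R. A \<in> carrier_mat d d \<Longrightarrow> R \<in> G \<Longrightarrow>
      entry_dist d (f n A * A) Qt < entry_dist d (R * A) Qt + inverse (real (Suc n))"
    by blast
  define W where "W n \<omega> = f n (Q n \<omega>)" for n \<omega>

  have conv: "(\<lambda>n. spectral_norm (W n \<omega> * Q n \<omega> - Qt)) \<longlonglongrightarrow> 0"
    if \<omega>: "\<omega> \<in> space M" and lim: "mat_tendsto d (\<lambda>n. S n \<omega>) \<Delta>" for \<omega>
  proof (rule tendstoI)
    fix e :: real assume e: "e > 0"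
    \<comment> \<open>Half of \<open>e\<close> goes to the distance from the orbit, half to the
      tolerance of the near-minimizer.\<close>
    have close: "\<forall>\<^sub>F n in sequentially. \<exists>R\<in>G. entry_dist d (R * Q n \<omega>) Qt < e / 2"
      unfolding G_def d_def
      by (rule pseudo_polar_eventually_close[OF pp[OF \<omega> lim] _ Qt]) (use lim e in \<open>simp_all add: d_def\<close>)
    have "\<forall>\<^sub>F n in sequentially. inverse (real (Suc n)) < e / 2"
      using LIMSEQ_inverse_real_of_nat by (rule order_tendstoD) (use e in simp)
    with close pp[OF \<omega> lim]
    show "\<forall>\<^sub>F n in sequentially. dist (spectral_norm (W n \<omega> * Q n \<omega> - Qt)) 0 < e"
    proof eventually_elim
      fix n assume "\<exists>R\<in>G. entry_dist d (R * Q n \<omega>) Qt < e / 2"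
        and pp: "pseudo_polar p q (S n \<omega>) (Q n \<omega>) (l n \<omega>)" and n: "inverse (real (Suc n)) < e / 2"
      then obtain R where R: "R \<in> G" "entry_dist d (R * Q n \<omega>) Qt < e / 2" by blast
      have Qn: "Q n \<omega> \<in> carrier_mat d d" using pseudo_polar_carrier(2)[OF pp] by (simp add: d_def)
      have WQ: "W n \<omega> * Q n \<omega> \<in> carrier_mat d d"
        using Qn G f(1) by (auto simp: W_def intro!: mult_carrier_mat[of _ d d])
      have "spectral_norm (W n \<omega> * Q n \<omega> - Qt) \<le> entry_dist d (W n \<omega> * Q n \<omega>) Qt"
        using spectral_norm_le_entries(2)[OF minus_carrier_mat[OF Qt_carrier, of "W n \<omega> * Q n \<omega>"]]
            Qt_carrier carrier_matD[OF WQ]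
        by (simp add: entry_dist_def)
      also have "\<dots> < e" using f_min[OF Qn R(1), of n] R(2) n by (simp add: W_def)
      finally show "dist (spectral_norm (W n \<omega> * Q n \<omega> - Qt)) 0 < e"
        using spectral_norm_le_entries(1)[of "W n \<omega> * Q n \<omega> - Qt" d] Qt_carrier
        by (simp add: dist_real_def minus_carrier_mat)
    qed
  qed
  show ?thesis
  proof (intro exI[of _ W] exI[of _ Qt] conjI allI ballI impI)
    show "W n \<omega> \<in> orth_group d \<inter> indef_orth_group p q" for n \<omega>
      using f(1)[of n "Q n \<omega>"] by (simp only: W_def G_def)
    show "W n \<in> M \<rightarrow>\<^sub>M borel_mat d d" if "Q n \<in> M \<rightarrow>\<^sub>M borel_mat d d" for n
      unfolding W_def using measurable_compose[OF that f(2)] .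
    show "AE \<omega> in M. (\<lambda>n. spectral_norm (W n \<omega> * Q n \<omega> - Qt)) \<longlonglongrightarrow> 0"
      using S_lim AE_space by eventually_elim (rule conv)
  qed (rule Qt_carrier)
qed

end
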